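(* Let $d\ge1$ be an integer and consider the classic final-time data $\varphi(\xi,\eta)=\frac12(\eta+|\xi|)$. Let $u^\varepsilon(t,m,\xi,\eta)$ be the scaled value function defined by the dynamic programming principle (see context) with final-time data $\varphi$. Let $C_d^\#$ and $C_d^*$ be the optimal values of the investor's and the market's linear programs respectively. Let $u_+(t,\xi,\eta)$ be the solution of $$u_t+\tfrac12 C\Big\langle D^2u\,\frac{\nabla^\perp u}{u_\eta},\frac{\nabla^\perp u}{u_\eta}\Big\rangle=0\ \ (t<T),\qquad u(T,\xi,\eta)=\varphi(\xi,\eta),$$ with $C=C_d^\#$, and let $u_-(t,\xi,\eta)$ be the solution of the same final-value problem with $C=C_d^*$. Then there is a constant $K$ (independent of $\varepsilon$, $t$, and $T$) such that $$u_-(t,\xi,\eta)-K\varepsilon|\log\varepsilon|\ \le\ u^\varepsilon(t,m,\xi,\eta)\ \le\ u_+(t,\xi,\eta)+K\varepsilon|\log\varepsilon|$$ for all $t<T$, $\xi\in\mathbb{R}$, $\eta\in\mathbb{R}$, and $m\in\{0,1\}^d$, provided that $\varepsilon>0$ is small enough and $t$ is such that $N=(T-t)/\varepsilon^2$ is an integer.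
   Context: States and experts. The states are $m=(a_1,\dots,a_d)\in\{0,1\}^d$ (with $a_d$ the most recent entry), identified with the integers $0,\dots,2^d-1$ by reading $a_1\cdots a_d$ in binary. For a state $m$ put $m_+=(a_2,\dots,a_d,1)$ and $m_-=(a_2,\dots,a_d,0)$; for $b=\pm1$ write $m_b=m_+$ if $b=1$ and $m_b=m_-$ if $b=-1$. Two experts are given by functions $q,r:\{0,1\}^d\to\mathbb{R}$ with $|q(m)|<1$ and $|r(m)|<1$ for all $m$, and $q(m)\ne r(m)$ for at least one $m$. Value function. For $\varepsilon>0$, $u^\varepsilon(t,m,\xi,\eta)$ is defined for times $t\le T$ with $(T-t)/\varepsilon^2$ a nonnegative integer, $m\in\{0,1\}^d$, $(\xi,\eta)\in\mathbb{R}^2$, by $u^\varepsilon(T,m,\xi,\eta)=\varphi(\xi,\eta)$ and, working backward in time, $$u^\varepsilon(t,m,\xi,\eta)=\min_{|f|\le1}\max_{b=\pm1}u^\varepsilon\big(t+\varepsilon^2,\,m_b,\,\xi+\varepsilon b[q(m)-r(m)],\,\eta+\varepsilon b[q(m)+r(m)-2f]\big).$$ Notation. $\nabla^\perp u=(-u_\eta,u_\xi)$ and $D^2u$ is the Hessian of $u$ in $(\xi,\eta)$. For the classic data, "the solution" of the final-value problem with constant $C$ means $u(t,\xi,\eta)=\frac12\eta+\overline u(t,\xi)$, where $\overline u$ is the (standard) solution of the linear heat equation $\overline u_t+\frac12C\,\overline u_{\xi\xi}=0$ for $t<T$ with $\overline u(T,\xi)=\frac12|\xi|$, i.e. $\overline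 u(t,\xi)=\frac12\int_{\mathbb{R}}\big|\xi+\sqrt{C(T-t)}\,z\big|\frac{e^{-z^2/2}}{\sqrt{2\pi}}\,dz$. Graph and linear programs. Consider the directed graph (the $d$-dimensional de Bruijn graph on 2 symbols) with vertex set $\{0,1\}^d$ and edges from $m$ to $m_+$ and from $m$ to $m_-$ for each $m$. A simple cycle is a closed walk with at least one edge and no repeated vertices apart from the first and last, which are equal (loops count as simple cycles of length one; cycles differing only in the starting vertex are identified). For a simple cycle $s$ let $|s|$ be its number of edges, and for a vertex $m$ on $s$ let $b_{s,m}=+1$ if $s$ leaves $m$ by the edge to $m_+$ and $b_{s,m}=-1$ if it leaves $m$ by the edge to $m_-$. The investor's linear program is: over $(\beta_0,\dots,\beta_{2^d-1},M)\in\mathbb{R}^{2^d+1}$, minimize $M$ subject to $$\sum_{m\text{ on }s}\big[(q(m)-r(m))^2-b_{s,m}\beta_m\big]\le |s|\,M\quad\text{for every simple cycle } s.$$ The market's linear program is: maximize $M$ subject to the same constraints with $\le$ replaced by $\ge$. *)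

theory Defs
  imports "HOL-Probability.Probability" "Graph_Theory.Graph_Theory"
begin

text \<open>
  A state \<open>(a\<^sub>1, \<dots>, a\<^sub>d)\<close> is a \<^typ>\<open>bool list\<close> of length \<open>d\<close> whose last entry is the most
  recent one. A sign \<open>b = \<plusminus>1\<close> is encoded by a Boolean, \<^const>\<open>True\<close> standing for \<open>+1\<close>,
  so that \<open>shift m True\<close> is \<open>m\<^sub>+\<close> and \<open>shift m False\<close> is \<open>m\<^sub>-\<close>.
\<close>

definition states :: "nat \<Rightarrow> bool list set" where
  "states d = {m. length m = d}"

definition shift :: "bool list \<Rightarrow> bool \<Rightarrow> bool list" where
  "shift m b = tl m @ [b]"

definition sign :: "bool \<Rightarrow> real" where
  "sign b = (if b then 1 else -1)"

definition classic_data :: "real \<Rightarrow> real \<Rightarrow> real" where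
  "classic_data \<xi> \<eta> = (\<eta> + \<bar>\<xi>\<bar>) / 2"

text \<open>
  The dynamic programming principle, indexed by the number of remaining time steps. The
  infimum over \<open>f\<close> is a minimum; for the classic data see \<open>value_min_attained\<close> below.
\<close>

primrec steps_value ::
  "(real \<Rightarrow> real \<Rightarrow> real) \<Rightarrow> (bool list \<Rightarrow> real) \<Rightarrow> (bool list \<Rightarrow> real) \<Rightarrow> real \<Rightarrow> nat \<Rightarrow>
   bool list \<Rightarrow> real \<Rightarrow> real \<Rightarrow> real" where
  "steps_value \<phi> q r \<epsilon> 0 m \<xi> \<eta> = \<phi> \<xi> \<eta>"
| "steps_value \<phi> q r \<epsilon> (Suc n) m \<xi> \<eta> =
     (INF f\<in>{-1..1::real}. MAX b\<in>(UNIV::bool set).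
        steps_value \<phi> q r \<epsilon> n (shift m b)
          (\<xi> + \<epsilon> * sign b * (q m - r m))
          (\<eta> + \<epsilon> * sign b * (q m + r m - 2 * f)))"

text \<open>
  The scaled value function; only meaningful when \<open>(T - t) / \<epsilon>\<^sup>2\<close> is a nonnegative integer.
\<close>

definition value_function ::
  "(real \<Rightarrow> real \<Rightarrow> real) \<Rightarrow> (bool list \<Rightarrow> real) \<Rightarrow> (bool list \<Rightarrow> real) \<Rightarrow> real \<Rightarrow> real \<Rightarrow>
   real \<Rightarrow> bool list \<Rightarrow> real \<Rightarrow> real \<Rightarrow> real" where
  "value_function \<phi> q r T \<epsilon> t m \<xi> \<eta> = steps_value \<phi> q r \<epsilon> (nat \<lfloor>(T - t) / \<epsilon>\<^sup>2\<rfloor>) m \<xi> \<eta>"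

lemma value_function_final:
  "value_function \<phi> q r T \<epsilon> T m \<xi> \<eta> = \<phi> \<xi> \<eta>"
  by (simp add: value_function_def)

lemma value_function_dpp:
  assumes "\<epsilon> > 0" "t < T" "(T - t) / \<epsilon>\<^sup>2 \<in> \<nat>"
  shows "value_function \<phi> q r T \<epsilon> t m \<xi> \<eta> =
     (INF f\<in>{-1..1::real}. MAX b\<in>(UNIV::bool set).
        value_function \<phi> q r T \<epsilon> (t + \<epsilon>\<^sup>2) (shift m b)
          (\<xi> + \<epsilon> * sign b * (q m - r m))
          (\<eta> + \<epsilon> * sign b * (q m + r m - 2 * f)))"
proof -
  from assms(3) obtain N where N: "(T - t) / \<epsilon>\<^sup>2 = real N"
    by (auto elim: Nats_cases)
  have "real N > 0"
    unfolding N[symmetric] using assms by simp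
  then obtain n where n: "N = Suc n"
    by (cases N) auto
  have "(T - (t + \<epsilon>\<^sup>2)) / \<epsilon>\<^sup>2 = (T - t) / \<epsilon>\<^sup>2 - 1"
    using assms(1) by (simp add: field_simps)
  also have "\<dots> = real n"
    using N n by simp
  finally have "nat \<lfloor>(T - (t + \<epsilon>\<^sup>2)) / \<epsilon>\<^sup>2\<rfloor> = n"
    by simp
  moreover have "nat \<lfloor>(T - t) / \<epsilon>\<^sup>2\<rfloor> = Suc n"
    using N n by simp
  ultimately show ?thesis
    by (simp add: value_function_def)
qed

lemma Max_bool:
  fixes g :: "bool \<Rightarrow> real"
  shows "(MAX b\<in>(UNIV::bool set). g b) = max (g True) (g False)"
  by (simp add: UNIV_bool max.commute)

lemma INF_attained:
  fixes h :: "real \<Rightarrow> real"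
  assumes "continuous_on {-1..1} h"
  shows "\<exists>f\<in>{-1..1}. (INF x\<in>{-1..1}. h x) = h f"
proof -
  obtain f where f: "f \<in> {-1..1}" "\<And>y. y \<in> {-1..1} \<Longrightarrow> h f \<le> h y"
    using continuous_attains_inf[of "{-1..1}" h] assms by auto
  have "(INF x\<in>{-1..1}. h x) = h f"
    by (rule cInf_eq_minimum) (use f in auto)
  then show ?thesis
    using f(1) by blast
qed

lemma steps_value_translate:
  "steps_value classic_data q r \<epsilon> n m \<xi> \<eta> = steps_value classic_data q r \<epsilon> n m \<xi> 0 + \<eta> / 2"
proof (induction n arbitrary: m \<xi> \<eta>)
  case 0
  then show ?case
    by (simp add: classic_data_def field_simps)
next
  case (Suc n)
  define W where "W b = steps_value classic_data q r \<epsilon> n (shift m b)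
    (\<xi> + \<epsilon> * sign b * (q m - r m)) 0" for b
  define h where "h f = (MAX b\<in>(UNIV::bool set).
    W b + (\<epsilon> * sign b * (q m + r m - 2 * f)) / 2)" for f
  have cont: "continuous_on {-1..1} h" 
    unfolding h_def Max_bool by (intro continuous_intros) auto
  have step: "steps_value classic_data q r \<epsilon> (Suc n) m \<xi> y = (INF f\<in>{-1..1}. h f + y / 2)" for y
  proof -
    have "(MAX b\<in>(UNIV::bool set). steps_value classic_data q r \<epsilon> n (shift m b)
        (\<xi> + \<epsilon> * sign b * (q m - r m)) (y + \<epsilon> * sign b * (q m + r m - 2 * f))) = h f + y / 2" for f
      unfolding Max_bool h_def W_def
      by (subst (1 2) Suc.IH) (simp add: max_def add_divide_distrib)
    then show ?thesis
      by simp
  qed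
  obtain f where f: "f \<in> {-1..1}" "(INF x\<in>{-1..1}. h x) = h f"
    using INF_attained[OF cont] by blast
  have bdd: "bdd_below (h ` {-1..1})"
    by (intro bounded_imp_bdd_below compact_imp_bounded compact_continuous_image cont compact_Icc)
  have "(INF x\<in>{-1..1}. h x + \<eta> / 2) = h f + \<eta> / 2"
  proof (rule cInf_eq_minimum)
    fix y assume "y \<in> (\<lambda>x. h x + \<eta> / 2) ` {-1..1}"
    then obtain x where x: "x \<in> {-1..1}" "y = h x + \<eta> / 2"
      by blast
    then show "h f + \<eta> / 2 \<le> y"
      using cINF_lower[OF bdd x(1)] f(2) by simp
  qed (use f in auto)
  then show ?case
    unfolding step using f(2) by simp
qed

lemma value_min_attained:
  "\<exists>f\<in>{-1..1}. steps_value classic_data q r \<epsilon> (Suc n) m \<xi> \<eta> =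
     (MAX b\<in>(UNIV::bool set). steps_value classic_data q r \<epsilon> n (shift m b)
        (\<xi> + \<epsilon> * sign b * (q m - r m)) (\<eta> + \<epsilon> * sign b * (q m + r m - 2 * f)))"
  unfolding steps_value.simps
  by (rule INF_attained, unfold Max_bool, subst (1 2) steps_value_translate,
      intro continuous_intros) auto

text \<open>
  An arc of the de Bruijn graph is a pair \<open>(m, b)\<close>, leading from \<open>m\<close> to \<open>shift m b\<close>, and
  walks are lists of arcs. Hence on a cycle \<open>s\<close> with an arc \<open>(m, b)\<close> the sign \<open>b\<^sub>s\<^sub>,\<^sub>m\<close>
  is \<open>sign b\<close>, and a sum over the vertices on \<open>s\<close> is a sum over its arcs, each vertex on
  \<open>s\<close> being the tail of exactly one of them.
\<close>

definition de_bruijn :: "nat \<Rightarrow> (bool list, bool list \<times> bool) pre_digraph" where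
  "de_bruijn d = \<lparr> verts = states d, arcs = states d \<times> UNIV,
                   tail = fst, head = (\<lambda>(m, b). shift m b) \<rparr>"

lemma wf_digraph_de_bruijn: "d \<ge> 1 \<Longrightarrow> wf_digraph (de_bruijn d)"
  by unfold_locales (auto simp: de_bruijn_def states_def shift_def)

text \<open>
  \<^const>\<open>pre_digraph.cycle\<close> is the notion of a simple cycle, loops included; the different
  starting vertices of a cycle give different arc lists but identical constraints.
\<close>

definition cycle_sum ::
  "(bool list \<Rightarrow> real) \<Rightarrow> (bool list \<Rightarrow> real) \<Rightarrow> (bool list \<Rightarrow> real) \<Rightarrow> (bool list \<times> bool) list \<Rightarrow> real" where
  "cycle_sum q r \<beta> s = (\<Sum>(m, b)\<leftarrow>s. (q m - r m)\<^sup>2 - sign b * \<beta> m)"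

definition investor_feasible ::
  "nat \<Rightarrow> (bool list \<Rightarrow> real) \<Rightarrow> (bool list \<Rightarrow> real) \<Rightarrow> (bool list \<Rightarrow> real) \<Rightarrow> real \<Rightarrow> bool" where
  "investor_feasible d q r \<beta> M \<longleftrightarrow>
     (\<forall>s. pre_digraph.cycle (de_bruijn d) s \<longrightarrow> cycle_sum q r \<beta> s \<le> real (length s) * M)"

definition market_feasible ::
  "nat \<Rightarrow> (bool list \<Rightarrow> real) \<Rightarrow> (bool list \<Rightarrow> real) \<Rightarrow> (bool list \<Rightarrow> real) \<Rightarrow> real \<Rightarrow> bool" where
  "market_feasible d q r \<beta> M \<longleftrightarrow>
     (\<forall>s. pre_digraph.cycle (de_bruijn d) s \<longrightarrow> cycle_sum q r \<beta> s \<ge> real (length s) * M)"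

definition investor_value :: "nat \<Rightarrow> (bool list \<Rightarrow> real) \<Rightarrow> (bool list \<Rightarrow> real) \<Rightarrow> real" where
  "investor_value d q r = Inf {M. \<exists>\<beta>. investor_feasible d q r \<beta> M}"

definition market_value :: "nat \<Rightarrow> (bool list \<Rightarrow> real) \<Rightarrow> (bool list \<Rightarrow> real) \<Rightarrow> real" where
  "market_value d q r = Sup {M. \<exists>\<beta>. market_feasible d q r \<beta> M}"

text \<open>
  For \<open>u(t, \<xi>, \<eta>) = \<eta> / 2 + v(t, \<xi>)\<close> the only nonzero entry of the Hessian is \<open>v\<^sub>\<xi>\<^sub>\<xi>\<close>, and
  the first component of \<open>\<nabla>\<^sup>\<bottom>u / u\<^sub>\<eta>\<close> is \<open>-1\<close>, so the final-value problem with constant \<open>C\<close>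
  and classic data is the linear heat equation \<open>v\<^sub>t + (C / 2) v\<^sub>\<xi>\<^sub>\<xi> = 0\<close> with
  \<open>v(T, \<xi>) = \<bar>\<xi>\<bar> / 2\<close>. Its standard solution is the Gaussian average below.
\<close>

definition heat_solution :: "real \<Rightarrow> real \<Rightarrow> real \<Rightarrow> real \<Rightarrow> real" where
  "heat_solution C T t \<xi> =
     1/2 * (LINT z|lborel. \<bar>\<xi> + sqrt (C * (T - t)) * z\<bar> * std_normal_density z)"

definition classic_solution :: "real \<Rightarrow> real \<Rightarrow> real \<Rightarrow> real \<Rightarrow> real \<Rightarrow> real" where
  "classic_solution C T t \<xi> \<eta> = 1/2 * \<eta> + heat_solution C T t \<xi>"

end

theory Submission
  imports Defs "HOL-Real_Asymp.Real_Asymp"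
begin

text \<open>
  Put \<open>D m = q m - r m\<close> and let \<open>C\<close> be the average of \<open>D\<^sup>2\<close> over all states. The theorem holds
  because the value function stays within \<open>K \<epsilon>\<close> of the solution with this constant \<open>C\<close>, while
  \<open>C\<close> lies between the two optimal values and the solution increases with its constant.

  The inequalities \<open>C\<^sub>d\<^sup>* \<le> C \<le> C\<^sub>d\<^sup>#\<close> are weak duality. If every arc of the de Bruijn graph
  carries the same weight, the terms \<open>b \<beta>\<^sub>m\<close> cancel and the average of the \<open>D\<^sup>2\<close> remains, so it is
  enough to split the set of all arcs into simple cycles. Moving the first entry of a state to the
  end, unchanged or flipped, gives two permutations of the states that together use each arc
  exactly once, and whose orbits are simple cycles (\<open>sum_arcs_nonpos\<close>).

  For the value function, replace the maximum over \<open>b\<close> by the average of its two values: the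
  investor's choice \<open>f\<close> drops out, and what remains is \<open>\<epsilon> E\<bar>\<xi> / \<epsilon> + S\<^sub>n\<bar> / 2 + \<eta> / 2\<close>, where
  \<open>S\<^sub>n\<close> is the sum of the \<open>b D\<close> along a walk with \<open>n\<close> fair independent signs. This is a lower bound.
  It is nearly attained: the investor can make both values equal as long as the required \<open>f\<close> lies
  in \<open>[-1, 1]\<close>. After an \<open>O(\<epsilon>)\<close> smoothing of the absolute value this is always so, since the value
  then depends on the state only by a small multiple of \<open>\<epsilon>\<close> (\<open>walk_avg_state_smooth\<close>), and
  since \<open>\<bar>q m + r m\<bar> / 2 + \<bar>D m\<bar> / 2 = max \<bar>q m\<bar> \<bar>r m\<bar> < 1\<close>.

  It remains to compare \<open>E\<bar>x + S\<^sub>n\<bar> / 2\<close> with the Gaussian average \<open>h (C n) x\<close>, where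
  \<open>h s x = E\<bar>x + sqrt s Z\<bar> / 2\<close>, up to a constant that is uniform in \<open>n\<close> and \<open>x\<close>
  (\<open>walk_avg_near_heat\<close>). The function \<open>h s x + \<gamma> m * h\<^sub>x\<^sub>x s x\<close>, with \<open>\<gamma>\<close> solving the Poisson
  equation for \<open>(D\<^sup>2 - C) / 2\<close> on the states, satisfies the one-step averaging equation up to
  errors of order \<open>s\<^sup>-\<^sup>3\<^sup>/\<^sup>2\<close>, which are summable, and a multiple of \<open>h\<^sub>x\<^sub>x\<^sub>x\<close>, which is only
  \<open>O(s\<^sup>-\<^sup>1)\<close>. Summing the latter directly would cost a logarithm of the number of steps and so a
  constant depending on \<open>T\<close>. But \<open>h\<^sub>x\<^sub>x\<^sub>x\<close> is concentrated on \<open>\<bar>x\<bar> = O(sqrt s)\<close>, and the bounded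
  function \<open>exp (- x\<^sup>2 / (4 s))\<close> is a strict supersolution of the heat equation there, with a surplus
  of the same size. A multiple of it absorbs these errors (\<open>barrier_step_bound\<close>).
\<close>

section \<open>Simple cycles covering the de Bruijn graph, and weak duality\<close>

text \<open>
  For either value of \<open>c\<close> this is a permutation of the states, and the two together run through
  all arcs: the entry dropped on the left determines, together with \<open>c\<close>, the entry added on the
  right.
\<close>
definition twist :: "bool \<Rightarrow> bool list \<Rightarrow> bool list" where
  "twist c m = shift m (c \<noteq> hd m)"

lemma shift_in_states: "d \<ge> 1 \<Longrightarrow> m \<in> states d \<Longrightarrow> shift m b \<in> states d"
  by (simp add: states_def shift_def)

lemma finite_states: "finite (states d)"
  using finite_lists_length_eq[of "UNIV :: bool set" d] by (simp add: states_def)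

lemma states_nonempty: "states d \<noteq> {}"
  by (auto simp: states_def intro!: exI[of _ "replicate d True"])

lemma twist_in_states: "d \<ge> 1 \<Longrightarrow> m \<in> states d \<Longrightarrow> twist c m \<in> states d"
  by (simp add: twist_def shift_in_states)

lemma bij_betw_twist:
  assumes "d \<ge> 1"
  shows "bij_betw (twist c) (states d) (states d)"
proof -
  have "inj_on (twist c) (states d)"
  proof (rule inj_onI)
    fix m m' assume *: "m \<in> states d" "m' \<in> states d" "twist c m = twist c m'"
    then have "m \<noteq> []" "m' \<noteq> []" "tl m = tl m'" "hd m = hd m'"
      using assms by (auto simp: states_def twist_def shift_def)
    then show "m = m'"
      by (simp add: list.expand)
  qed
  moreover have "twist c ` states d \<subseteq> states d"
    using twist_in_states[OF assms] by blast
  ultimately show ?thesis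
    using finite_states endo_inj_surj unfolding bij_betw_def by blast
qed

text \<open>
  Each application moves the next entry to the end, flipping it if \<open>c\<close> is true. After \<open>d\<close>
  applications all entries are flipped or none is, so \<open>2 d\<close> applications give the identity.
\<close>
lemma funpow_twist:
  assumes "k \<le> length m"
  shows "(twist c ^^ k) m = drop k m @ map (\<lambda>a. c \<noteq> a) (take k m)"
  using assms
proof (induction k)
  case (Suc k)
  then have "drop k m = m ! k # drop (Suc k) m" "take (Suc k) m = take k m @ [m ! k]"
    by (auto simp: Cons_nth_drop_Suc take_Suc_conv_app_nth)
  with Suc show ?case
    by (simp add: twist_def shift_def)
qed simp

lemma twist_period:
  assumes "m \<in> states d"
  shows "(twist c ^^ (2 * d)) m = m"
proof -
  have flip: "(twist c ^^ d) m' = map (\<lambda>a. c \<noteq> a) m'" if "length m' = d" for m'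
    using funpow_twist[of d m' c] that by simp
  have "(twist c ^^ (2 * d)) m = (twist c ^^ d) ((twist c ^^ d) m)"
    by (simp only: mult_2 funpow_add comp_apply)
  also have "\<dots> = map (\<lambda>a. c \<noteq> (c \<noteq> a)) m"
    using assms by (simp add: flip states_def)
  also have "\<dots> = m"
    by (cases c) (auto intro: map_idI)
  finally show ?thesis .
qed

primrec twist_walk :: "bool \<Rightarrow> nat \<Rightarrow> bool list \<Rightarrow> (bool list \<times> bool) list" where
  "twist_walk c 0 m = []"
| "twist_walk c (Suc n) m = (m, c \<noteq> hd m) # twist_walk c n (twist c m)"

lemma length_twist_walk: "length (twist_walk c n m) = n"
  by (induction n arbitrary: m) auto

lemma sum_list_twist_walk:
  "(\<Sum>a\<leftarrow>twist_walk c n m. w a) = (\<Sum>i<n. w ((twist c ^^ i) m, c \<noteq> hd ((twist c ^^ i) m)))"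
  by (induction n arbitrary: m)
    (auto simp: sum.lessThan_Suc_shift funpow_Suc_right simp del: funpow.simps(2) sum.lessThan_Suc)

lemma de_bruijn_simps:
  "verts (de_bruijn d) = states d" "arcs (de_bruijn d) = states d \<times> UNIV"
  "tail (de_bruijn d) (m, b) = m" "head (de_bruijn d) (m, b) = shift m b"
  by (simp_all add: de_bruijn_def)

lemma head_twist: "head (de_bruijn d) (m, c \<noteq> hd m) = twist c m"
  by (simp add: de_bruijn_simps twist_def)

lemma awalk_twist_walk:
  assumes "d \<ge> 1" "m \<in> states d"
  shows "pre_digraph.awalk (de_bruijn d) m (twist_walk c n m) ((twist c ^^ n) m)"
proof -
  interpret wf_digraph "de_bruijn d"
    using assms(1) by (rule wf_digraph_de_bruijn)
  show ?thesis
    using assms(2)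
  proof (induction n arbitrary: m)
    case 0
    then show ?case
      by (simp add: awalk_Nil_iff de_bruijn_simps)
  next
    case (Suc n)
    then show ?case
      using Suc.IH[of "twist c m"] twist_in_states[OF assms(1)]
      by (simp add: awalk_Cons_iff de_bruijn_simps(1-3) head_twist[simplified] funpow_Suc_right
          del: funpow.simps(2))
  qed
qed

lemma awalk_verts_twist_walk:
  "pre_digraph.awalk_verts (de_bruijn d) u (twist_walk c n m) =
     (if n = 0 then [u] else map (\<lambda>i. (twist c ^^ i) m) [0..<Suc n])"
proof (induction n arbitrary: u m)
  case (Suc n)
  have "map (\<lambda>i. (twist c ^^ i) m) [0..<Suc (Suc n)] =
        m # map (\<lambda>i. (twist c ^^ i) (twist c m)) [0..<Suc n]"
    by (simp add: map_upt_Suc funpow_Suc_right del: funpow.simps(2) upt_Suc)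
  then show ?case
    using Suc.IH
    by (simp add: pre_digraph.awalk_verts.simps de_bruijn_simps(1-3) head_twist[simplified] del: upt_Suc) simp
qed (simp add: pre_digraph.awalk_verts.simps)

text \<open>
  Two equal states on the orbit before the first return would give an earlier return: go
  on from both of them for the same number of steps until the later one has come back to \<open>m\<close>.
\<close>
lemma twist_orbit_cycle:
  assumes "d \<ge> 1" "m \<in> states d" "k > 0" "(twist c ^^ k) m = m"
    and least: "\<And>j. 0 < j \<Longrightarrow> j < k \<Longrightarrow> (twist c ^^ j) m \<noteq> m"
  shows "pre_digraph.cycle (de_bruijn d) (twist_walk c k m)"
proof -
  have neq: "(twist c ^^ i) m \<noteq> (twist c ^^ j) m" if "i < j" "j \<le> k" "0 < i" for i j
  proof
    assume eq: "(twist c ^^ i) m = (twist c ^^ j) m"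
    have "(twist c ^^ (j - i)) m = (twist c ^^ (j - i)) ((twist c ^^ k) m)"
      using assms(4) by simp
    also have "\<dots> = (twist c ^^ (j - i + k)) m"
      by (simp add: funpow_add)
    also have "j - i + k = k - i + j"
      using that by simp
    also have "(twist c ^^ (k - i + j)) m = (twist c ^^ (k - i)) ((twist c ^^ i) m)"
      using eq by (simp add: funpow_add)
    also have "\<dots> = (twist c ^^ (k - i + i)) m"
      by (simp only: funpow_add comp_apply)
    also have "\<dots> = m"
      using that assms(4) by simp
    finally show False
      using least[of "j - i"] that by simp
  qed
  have "inj_on (\<lambda>i. (twist c ^^ i) m) {1..<Suc k}"
    by (rule linorder_inj_onI) (use neq in auto)
  moreover have "tl [0..<Suc k] = [1..<Suc k]"
    by (simp del: upt_Suc)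
  ultimately have "distinct (tl (map (\<lambda>i. (twist c ^^ i) m) [0..<Suc k]))"
    by (simp add: map_tl[symmetric] distinct_map del: upt_Suc)
  then show ?thesis
    using awalk_twist_walk[OF assms(1,2), of c k] assms(3,4) length_twist_walk[of c k m]
    by (auto simp: pre_digraph.cycle_def awalk_verts_twist_walk simp del: upt_Suc)
qed

text \<open>
  The uniform weight on the arcs is a combination of simple cycles. For each permutation
  \<open>twist c\<close>, the closed walk of length \<open>2 d\<close> from a state runs a whole number of times through
  the cycle of that state; adding these walks over all starting states counts every arc of the
  permutation \<open>2 d\<close> times.
\<close>
lemma sum_arcs_nonpos:
  fixes w :: "bool list \<times> bool \<Rightarrow> real"
  assumes d: "d \<ge> 1"
    and cyc: "\<And>s. pre_digraph.cycle (de_bruijn d) s \<Longrightarrow> (\<Sum>a\<leftarrow>s. w a) \<le> 0"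
  shows "(\<Sum>m\<in>states d. w (m, True) + w (m, False)) \<le> 0"
proof -
  have half: "(\<Sum>m\<in>states d. w (m, c \<noteq> hd m)) \<le> 0" for c
  proof -
    define v where "v m = w (m, c \<noteq> hd m)" for m
    have orbit: "(\<Sum>i<2 * d. v ((twist c ^^ i) m)) \<le> 0" if m: "m \<in> states d" for m
    proof -
      define k where "k = (LEAST k. 0 < k \<and> (twist c ^^ k) m = m)"
      have k: "0 < k \<and> (twist c ^^ k) m = m"
        unfolding k_def by (rule LeastI[of _ "2 * d"]) (use d twist_period[OF m] in auto)
      have least: "(twist c ^^ j) m \<noteq> m" if "0 < j" "j < k" for j
        using not_less_Least[of j "\<lambda>k. 0 < k \<and> (twist c ^^ k) m = m"] that
        unfolding k_def by auto
      have "(twist c ^^ (2 * d mod k)) m = m"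
        using funpow_mod_eq[where f = "twist c" and n = k and x = m and m = "2 * d"] k twist_period[OF m]
        by simp
      then have "2 * d mod k = 0"
        using least[of "2 * d mod k"] k by (meson mod_less_divisor neq0_conv)
      then obtain n where n: "2 * d = n * k"
        by (metis mod_0_imp_dvd dvd_def mult.commute)
      have "(\<Sum>i<k. v ((twist c ^^ i) m)) \<le> 0"
        using cyc[OF twist_orbit_cycle[OF d m _ _ least]] k
        by (simp add: sum_list_twist_walk v_def)
      moreover have "(\<Sum>i = j * k..<j * k + k. v ((twist c ^^ i) m)) = (\<Sum>i<k. v ((twist c ^^ i) m))" for j
      proof -
        have "(\<Sum>i = j * k..<j * k + k. v ((twist c ^^ i) m)) =
              (\<Sum>i = 0..<k. v ((twist c ^^ (i + j * k)) m))"
          using sum.shift_bounds_nat_ivl[of "\<lambda>i. v ((twist c ^^ i) m)" 0 "j * k" k]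
          by (simp add: add.commute)
        also have "\<dots> = (\<Sum>i = 0..<k. v ((twist c ^^ i) m))"
        proof -
          have "(twist c ^^ (i + j * k)) m = (twist c ^^ i) m" for i
            using funpow_mod_eq[where f = "twist c" and n = k and x = m and m = "i + j * k"]
              funpow_mod_eq[where f = "twist c" and n = k and x = m and m = i] k by simp
          then show ?thesis by simp
        qed
        finally show ?thesis by (simp add: lessThan_atLeast0)
      qed
      ultimately have "(\<Sum>j<n. \<Sum>i = j * k..<j * k + k. v ((twist c ^^ i) m)) \<le> 0"
        by (simp add: sum_nonpos mult_nonneg_nonpos)
      then show ?thesis
        by (simp add: n sum.nat_group)
    qed
    have bij: "bij_betw (twist c ^^ i) (states d) (states d)" for i
      using bij_betw_twist[OF d] by (rule bij_betw_funpow)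
    have "real (2 * d) * (\<Sum>m\<in>states d. v m) = (\<Sum>i<2 * d. \<Sum>m\<in>states d. v ((twist c ^^ i) m))"
      using sum.reindex_bij_betw[OF bij, of v] by simp
    also have "\<dots> = (\<Sum>m\<in>states d. \<Sum>i<2 * d. v ((twist c ^^ i) m))"
      by (rule sum.swap)
    also have "\<dots> \<le> 0"
      using orbit by (rule sum_nonpos)
    finally have "real (2 * d) * (\<Sum>m\<in>states d. v m) \<le> 0" .
    moreover have "real (2 * d) > 0"
      using d by simp
    ultimately show ?thesis
      unfolding v_def[symmetric] by (simp only: mult_le_0_iff) linarith
  qed
  have "(\<Sum>m\<in>states d. w (m, True) + w (m, False)) =
        (\<Sum>m\<in>states d. w (m, False \<noteq> hd m) + w (m, True \<noteq> hd m))"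
  proof (rule sum.cong)
    fix m show "w (m, True) + w (m, False) = w (m, False \<noteq> hd m) + w (m, True \<noteq> hd m)"
      by (cases "hd m") auto
  qed simp
  also have "\<dots> \<le> 0"
    unfolding sum.distrib using half[of True] half[of False] by simp
  finally show ?thesis .
qed

definition state_mean :: "nat \<Rightarrow> (bool list \<Rightarrow> real) \<Rightarrow> real" where
  "state_mean d f = (\<Sum>m\<in>states d. f m) / card (states d)"

lemma card_states_pos: "card (states d) > 0"
  by (simp add: card_gt_0_iff finite_states states_nonempty)

text \<open>
  The two arcs leaving a state contribute opposite multiples of \<open>\<beta> m\<close>, so \<open>\<beta>\<close> cancels from the
  sum of the constraints over all arcs.
\<close>
lemma investor_feasible_ge_mean:
  assumes "d \<ge> 1" "investor_feasible d q r \<beta> M"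
  shows "state_mean d (\<lambda>m. (q m - r m)\<^sup>2) \<le> M"
proof -
  have "(\<Sum>(m, b)\<leftarrow>s. (q m - r m)\<^sup>2 - sign b * \<beta> m - M) = cycle_sum q r \<beta> s - real (length s) * M" for s
    by (induction s) (auto simp: cycle_sum_def algebra_simps)
  then have "(\<Sum>a\<leftarrow>s. case a of (m, b) \<Rightarrow> (q m - r m)\<^sup>2 - sign b * \<beta> m - M) \<le> 0"
    if "pre_digraph.cycle (de_bruijn d) s" for s
    using assms(2) that by (auto simp: investor_feasible_def)
  from sum_arcs_nonpos[OF assms(1) this]
  have "(\<Sum>m\<in>states d. 2 * ((q m - r m)\<^sup>2 - M)) \<le> 0"
    by (simp add: sign_def algebra_simps)
  then have "(\<Sum>m\<in>states d. (q m - r m)\<^sup>2) \<le> card (states d) * M"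
    unfolding sum_distrib_left[symmetric] by (simp add: sum_subtractf)
  then show ?thesis
    using card_states_pos[of d] by (simp add: state_mean_def field_simps)
qed

lemma market_feasible_le_mean:
  assumes "d \<ge> 1" "market_feasible d q r \<beta> M"
  shows "M \<le> state_mean d (\<lambda>m. (q m - r m)\<^sup>2)"
proof -
  have "(\<Sum>(m, b)\<leftarrow>s. M - ((q m - r m)\<^sup>2 - sign b * \<beta> m)) = real (length s) * M - cycle_sum q r \<beta> s" for s
    by (induction s) (auto simp: cycle_sum_def algebra_simps)
  then have "(\<Sum>a\<leftarrow>s. case a of (m, b) \<Rightarrow> M - ((q m - r m)\<^sup>2 - sign b * \<beta> m)) \<le> 0"
    if "pre_digraph.cycle (de_bruijn d) s" for s
    using assms(2) that by (auto simp: market_feasible_def)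
  from sum_arcs_nonpos[OF assms(1) this]
  have "(\<Sum>m\<in>states d. 2 * (M - (q m - r m)\<^sup>2)) \<le> 0"
    by (simp add: sign_def algebra_simps)
  then have "card (states d) * M \<le> (\<Sum>m\<in>states d. (q m - r m)\<^sup>2)"
    unfolding sum_distrib_left[symmetric] by (simp add: sum_subtractf)
  then show ?thesis
    using card_states_pos[of d] by (simp add: state_mean_def field_simps)
qed

lemma de_bruijn_cycle_tails:
  assumes "pre_digraph.cycle (de_bruijn d) s" "(m, b) \<in> set s"
  shows "m \<in> states d"
proof -
  have "set s \<subseteq> arcs (de_bruijn d)"
    using assms(1) by (auto simp: pre_digraph.cycle_def pre_digraph.awalk_def)
  then show ?thesis
    using assms(2) by (auto simp: de_bruijn_def)
qed

text \<open>
  A feasible point is needed as well as the bound, since the infimum of the empty set of reals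
  carries no information; \<open>\<beta> = 0\<close> gives one.
\<close>
lemma investor_value_ge_mean:
  assumes "d \<ge> 1" and bound: "\<And>m. m \<in> states d \<Longrightarrow> (q m - r m)\<^sup>2 \<le> B"
  shows "state_mean d (\<lambda>m. (q m - r m)\<^sup>2) \<le> investor_value d q r"
  unfolding investor_value_def
proof (rule cInf_greatest)
  have "cycle_sum q r (\<lambda>_. 0) s \<le> real (length s) * B"
    if "\<And>m b. (m, b) \<in> set s \<Longrightarrow> m \<in> states d" for s
    using that
  proof (induction s)
    case (Cons a s)
    have "fst a \<in> states d"
      using Cons.prems by (metis list.set_intros(1) prod.collapse)
    moreover have "cycle_sum q r (\<lambda>_. 0) s \<le> real (length s) * B"
      using Cons.prems by (intro Cons.IH) auto
    ultimately show ?case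
      using bound[of "fst a"]
      by (auto simp: cycle_sum_def algebra_simps split: prod.splits)
  qed (simp add: cycle_sum_def)
  then have "investor_feasible d q r (\<lambda>_. 0) B"
    using de_bruijn_cycle_tails unfolding investor_feasible_def by blast
  then show "{M. \<exists>\<beta>. investor_feasible d q r \<beta> M} \<noteq> {}"
    by blast
qed (use investor_feasible_ge_mean[OF assms(1)] in blast)

lemma market_value_le_mean:
  assumes "d \<ge> 1"
  shows "0 \<le> market_value d q r"
    and "market_value d q r \<le> state_mean d (\<lambda>m. (q m - r m)\<^sup>2)"
proof -
  have "cycle_sum q r (\<lambda>_. 0) s \<ge> 0" for s
    by (induction s) (auto simp: cycle_sum_def)
  then have "market_feasible d q r (\<lambda>_. 0) 0"
    by (simp add: market_feasible_def)
  then have zero: "0 \<in> {M. \<exists>\<beta>. market_feasible d q r \<beta> M}"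
    by blast
  have upper: "M \<le> state_mean d (\<lambda>m. (q m - r m)\<^sup>2)" if "M \<in> {M. \<exists>\<beta>. market_feasible d q r \<beta> M}" for M
    using market_feasible_le_mean[OF assms] that by blast
  show "0 \<le> market_value d q r"
    unfolding market_value_def using zero upper by (intro cSup_upper bdd_aboveI)
  show "market_value d q r \<le> state_mean d (\<lambda>m. (q m - r m)\<^sup>2)"
    unfolding market_value_def using zero upper by (intro cSup_least) auto
qed

section \<open>The game and averages over fair signs\<close>

text \<open>
  The expectation of \<open>g (x + S\<^sub>n)\<close>, where \<open>S\<^sub>n\<close> is the sum of the \<open>b D\<close> over \<open>n\<close> steps from the
  state \<open>m\<close> with independent fair signs \<open>b\<close>.
\<close>
primrec walk_avg ::
  "(bool list \<Rightarrow> real) \<Rightarrow> (real \<Rightarrow> real) \<Rightarrow> nat \<Rightarrow> bool list \<Rightarrow> real \<Rightarrow> real" where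
  "walk_avg D g 0 m x = g x"
| "walk_avg D g (Suc n) m x =
     (walk_avg D g n (shift m True) (x + D m) + walk_avg D g n (shift m False) (x - D m)) / 2"

lemma walk_avg_mono: "(\<And>x. g x \<le> g' x) \<Longrightarrow> walk_avg D g n m x \<le> walk_avg D g' n m x"
proof (induction n arbitrary: m x)
  case (Suc n)
  from Suc.IH[OF Suc.prems, of "shift m True" "x + D m"] Suc.IH[OF Suc.prems, of "shift m False" "x - D m"]
  show ?case by simp
qed simp

lemma walk_avg_add_const: "walk_avg D (\<lambda>x. g x + c) n m x = walk_avg D g n m x + c"
  by (induction n arbitrary: m x) (auto simp: field_simps)

lemma abs_average_diff_le:
  fixes a b a' b' :: real
  shows "\<bar>a - a'\<bar> \<le> e \<Longrightarrow> \<bar>b - b'\<bar> \<le> e \<Longrightarrow> \<bar>(a + b) / 2 - (a' + b') / 2\<bar> \<le> e"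
  by (auto simp: abs_le_iff field_simps)

lemma walk_avg_lipschitz:
  assumes "\<And>x y. \<bar>g x - g y\<bar> \<le> L * \<bar>x - y\<bar>"
  shows "\<bar>walk_avg D g n m x - walk_avg D g n m y\<bar> \<le> L * \<bar>x - y\<bar>"
proof (induction n arbitrary: m x y)
  case (Suc n)
  show ?case
    unfolding walk_avg.simps
    using Suc.IH[of "shift m True" "x + D m" "y + D m"] Suc.IH[of "shift m False" "x - D m" "y - D m"]
    by (intro abs_average_diff_le) simp_all
qed (simp add: assms)

lemma walk_avg_DERIV:
  assumes "\<And>x. (g has_real_derivative g' x) (at x)"
  shows "(walk_avg D g n m has_real_derivative walk_avg D g' n m x) (at x)"
proof (induction n arbitrary: m x)
  case (Suc n)
  have "((\<lambda>x. walk_avg D g n m' (x + a)) has_real_derivative walk_avg D g' n m' (x + a)) (at x)" for m' a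
    using Suc.IH[of m' "x + a"] by (simp add: DERIV_shift)
  from this[of _ "D m"] this[of _ "- D m"]
  have "((\<lambda>x. (walk_avg D g n (shift m True) (x + D m) + walk_avg D g n (shift m False) (x - D m)) / 2)
      has_real_derivative walk_avg D g' (Suc n) m x) (at x)"
    by (auto intro!: derivative_eq_intros)
  then show ?case
    by simp
next
  case 0
  have "walk_avg D g 0 m = g"
    by (simp add: fun_eq_iff)
  then show ?case
    using assms by simp
qed

lemma drop_shift:
  assumes "Suc k \<le> d" "m \<in> states d" "m' \<in> states d" "drop (Suc k) m = drop (Suc k) m'"
  shows "drop k (shift m b) = drop k (shift m' b)"
  using assms by (simp add: shift_def states_def drop_Suc tl_drop)

text \<open>
  Two walks that use the same signs agree in their states once the \<open>k\<close> differing entries have been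
  shifted out; each earlier step moves their sums apart by at most 4.
\<close>
lemma walk_avg_state_crude:
  assumes d: "d \<ge> 1"
    and D: "\<And>m. m \<in> states d \<Longrightarrow> \<bar>D m\<bar> \<le> 2"
    and lip: "\<And>x y. \<bar>g x - g y\<bar> \<le> L * \<bar>x - y\<bar>"
  shows "k \<le> d \<Longrightarrow> m \<in> states d \<Longrightarrow> m' \<in> states d \<Longrightarrow> drop k m = drop k m' \<Longrightarrow>
    \<bar>walk_avg D g n m x - walk_avg D g n m' x\<bar> \<le> 4 * real k * L"
proof (induction k arbitrary: n m m' x)
  case 0
  then show ?case by simp
next
  case (Suc k)
  have "0 \<le> L"
    using lip[of 1 0] by simp
  show ?case
  proof (cases n)
    case 0
    then show ?thesis using \<open>0 \<le> L\<close> by simp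
  next
    case (Suc n')
    have step: "\<bar>walk_avg D g n' (shift m b) (x + s * D m) - walk_avg D g n' (shift m' b) (x + s * D m')\<bar>
        \<le> 4 * real (Suc k) * L" if "\<bar>s\<bar> = 1" for b s
    proof -
      have "\<bar>walk_avg D g n' (shift m b) (x + s * D m) - walk_avg D g n' (shift m b) (x + s * D m')\<bar>
          \<le> L * \<bar>(x + s * D m) - (x + s * D m')\<bar>"
        by (rule walk_avg_lipschitz[OF lip])
      also have "(x + s * D m) - (x + s * D m') = s * (D m - D m')"
        by (simp add: algebra_simps)
      also have "L * \<bar>s * (D m - D m')\<bar> \<le> L * 4"
        using D[OF Suc.prems(2)] D[OF Suc.prems(3)] \<open>0 \<le> L\<close> that
        by (intro mult_left_mono) (auto simp: abs_mult)
      finally have 1: "\<bar>walk_avg D g n' (shift m b) (x + s * D m)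
          - walk_avg D g n' (shift m b) (x + s * D m')\<bar> \<le> L * 4" .
      have 2: "\<bar>walk_avg D g n' (shift m b) (x + s * D m') - walk_avg D g n' (shift m' b) (x + s * D m')\<bar>
          \<le> 4 * real k * L"
        using Suc.prems drop_shift[OF Suc.prems]
        by (intro Suc.IH) (auto intro: shift_in_states[OF d])
      show ?thesis
        using 1 2 by (simp add: algebra_simps)
    qed
    show ?thesis
      unfolding Suc walk_avg.simps using step[of 1 True] step[of "-1" False]
      by (intro abs_average_diff_le) simp_all
  qed
qed

text \<open>
  Iterating this bound gives Taylor estimates of any order from a bound on the highest derivative.
\<close>
lemma integrated_power_bound:
  fixes G G' :: "real \<Rightarrow> real"
  assumes "\<And>t. (G has_real_derivative G' t) (at t)" "G 0 = 0"
    and bound: "\<And>t. \<bar>G' t\<bar> \<le> K * \<bar>t\<bar> ^ k"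
  shows "\<bar>G h\<bar> \<le> K * \<bar>h\<bar> ^ Suc k"
proof -
  have "0 \<le> K"
    using bound[of 1] by simp
  have "norm (G h - G 0) \<le> (K * \<bar>h\<bar> ^ k) * norm (h - 0)"
  proof (rule field_differentiable_bound[of "{-\<bar>h\<bar>..\<bar>h\<bar>}" G G'])
    fix t assume "t \<in> {-\<bar>h\<bar>..\<bar>h\<bar>}"
    then have "K * \<bar>t\<bar> ^ k \<le> K * \<bar>h\<bar> ^ k"
      using \<open>0 \<le> K\<close> by (intro mult_left_mono power_mono) auto
    then show "norm (G' t) \<le> K * \<bar>h\<bar> ^ k"
      using bound[of t] by simp
  qed (use assms(1) in \<open>auto intro: has_field_derivative_at_within\<close>)
  then show ?thesis
    using assms(2) by (simp add: mult_ac)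
qed

lemma DERIV_translate:
  fixes F :: "real \<Rightarrow> real"
  shows "(\<And>x. (F has_real_derivative F' x) (at x)) \<Longrightarrow>
    ((\<lambda>t. F (x + t)) has_real_derivative F' (x + t)) (at t)"
  by (simp add: DERIV_shift[of F "F' (x + t)" t x] add.commute flip: DERIV_shift)

lemma DERIV_lipschitz_linear_bound:
  fixes F F' :: "real \<Rightarrow> real"
  assumes der: "\<And>x. (F has_real_derivative F' x) (at x)"
    and lip: "\<And>x y. \<bar>F' x - F' y\<bar> \<le> L * \<bar>x - y\<bar>"
  shows "\<bar>F (x + h) - F x - h * F' x\<bar> \<le> L * h\<^sup>2"
proof -
  have "\<bar>F (x + h) - F x - h * F' x\<bar> \<le> L * \<bar>h\<bar> ^ Suc 1"
  proof (rule integrated_power_bound[where G' = "\<lambda>t. F' (x + t) - F' x"])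
    show "((\<lambda>t. F (x + t) - F x - t * F' x) has_real_derivative F' (x + t) - F' x) (at t)" for t
      using DERIV_translate[OF der] by (auto intro!: derivative_eq_intros)
    show "\<bar>F' (x + t) - F' x\<bar> \<le> L * \<bar>t\<bar> ^ 1" for t
      using lip[of "x + t" x] by simp
  qed simp
  then show ?thesis
    by (simp add: power2_eq_square abs_mult_self_eq)
qed

text \<open>
  In contrast to \<open>walk_avg_state_crude\<close>, the bound involves the Lipschitz constant of the
  \<^emph>\<open>derivative\<close> of \<open>g\<close>, which smoothing makes as small as desired. To first order in the
  distance, one step from \<open>m\<close> and from \<open>m'\<close> differ by \<open>D m - D m'\<close> times the difference of
  the slopes at the two successor states: the leading parts cancel because the sign is fair. That
  difference is controlled by the crude bound applied to \<open>g'\<close>.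
\<close>
lemma walk_avg_state_smooth:
  assumes d: "d \<ge> 1"
    and D: "\<And>m. m \<in> states d \<Longrightarrow> \<bar>D m\<bar> \<le> 2"
    and der: "\<And>x. (g has_real_derivative g' x) (at x)"
    and lip: "\<And>x y. \<bar>g' x - g' y\<bar> \<le> L * \<bar>x - y\<bar>"
  shows "k \<le> d \<Longrightarrow> m \<in> states d \<Longrightarrow> m' \<in> states d \<Longrightarrow> drop k m = drop k m' \<Longrightarrow>
    \<bar>walk_avg D g n m x - walk_avg D g n m' x\<bar> \<le> 8 * (real d + 1) * real k * L"
proof (induction k arbitrary: n m m' x)
  case 0
  then show ?case by simp
next
  case (Suc k)
  have L: "0 \<le> L"
    using lip[of 1 0] by simp
  show ?case
  proof (cases n)
    case 0
    then show ?thesis using L by simp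
  next
    case (Suc n')
    define F where "F b = walk_avg D g n' (shift m b)" for b
    define F' where "F' b = walk_avg D g' n' (shift m b)" for b
    have lin: "\<bar>F b (x + h) - F b x - h * F' b x\<bar> \<le> 4 * L" if "\<bar>h\<bar> \<le> 2" for b h
    proof -
      have "\<bar>F b (x + h) - F b x - h * F' b x\<bar> \<le> L * h\<^sup>2"
        unfolding F_def F'_def
        by (rule DERIV_lipschitz_linear_bound[OF walk_avg_DERIV[OF der] walk_avg_lipschitz[OF lip]])
      also have "\<dots> \<le> L * 4"
        using abs_le_square_iff[of h 2] that L by (intro mult_left_mono) auto
      finally show ?thesis by simp
    qed
    have "\<bar>F' True x - F' False x\<bar> \<le> 4 * real d * L"
      unfolding F'_def
      by (rule walk_avg_state_crude[OF d D lip])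
        (use Suc.prems shift_in_states[OF d] in \<open>auto simp: states_def\<close>)
    moreover have "\<bar>D m - D m'\<bar> \<le> 4"
      using D[OF Suc.prems(2)] D[OF Suc.prems(3)] by simp
    ultimately have slope: "\<bar>(D m - D m') * (F' True x - F' False x)\<bar> \<le> 4 * (4 * real d * L)"
      unfolding abs_mult by (intro mult_mono) auto
    have IH: "\<bar>F b y - walk_avg D g n' (shift m' b) y\<bar> \<le> 8 * (real d + 1) * real k * L" for b y
      unfolding F_def using Suc.prems drop_shift[OF Suc.prems]
      by (intro Suc.IH) (auto intro: shift_in_states[OF d])
    \<comment> \<open>Four linearization errors, the slope term, and the two differences left to the induction.\<close>
    have eq: "2 * (walk_avg D g n m x - walk_avg D g n m' x) =
        (F True (x + D m) - F True x - D m * F' True x)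
      - (F True (x + D m') - F True x - D m' * F' True x)
      + (F False (x + - D m) - F False x - (- D m) * F' False x)
      - (F False (x + - D m') - F False x - (- D m') * F' False x)
      + (D m - D m') * (F' True x - F' False x)
      + (F True (x + D m') - walk_avg D g n' (shift m' True) (x + D m'))
      + (F False (x + - D m') - walk_avg D g n' (shift m' False) (x + - D m'))"
      unfolding Suc F_def by (simp add: field_simps)
    have triangle: "2 * \<bar>z\<bar> \<le> 4 * P + S + 2 * U"
      if "2 * z = a1 - a2 + a3 - a4 + s + u1 + u2"
        "\<bar>a1\<bar> \<le> P" "\<bar>a2\<bar> \<le> P" "\<bar>a3\<bar> \<le> P" "\<bar>a4\<bar> \<le> P" "\<bar>s\<bar> \<le> S" "\<bar>u1\<bar> \<le> U" "\<bar>u2\<bar> \<le> U"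
      for z a1 a2 a3 a4 s u1 u2 P S U :: real
      using that by linarith
    have "2 * \<bar>walk_avg D g n m x - walk_avg D g n m' x\<bar> \<le>
        4 * (4 * L) + 4 * (4 * real d * L) + 2 * (8 * (real d + 1) * real k * L)"
      by (rule triangle[OF eq _ _ _ _ slope IH IH]; rule lin)
        (use D[OF Suc.prems(2)] D[OF Suc.prems(3)] in auto)
    then show ?thesis
      by (simp add: algebra_simps)
  qed
qed

text \<open>
  The market may pick its sign at random. Whatever \<open>f\<close> is, the terms with \<open>f\<close> in the two
  possible outcomes then cancel.
\<close>
lemma steps_value_ge_walk_avg:
  assumes "\<epsilon> > 0"
  shows "\<epsilon> * walk_avg (\<lambda>m. q m - r m) (\<lambda>x. \<bar>x\<bar> / 2) n m (\<xi> / \<epsilon>) + \<eta> / 2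
           \<le> steps_value classic_data q r \<epsilon> n m \<xi> \<eta>"
proof (induction n arbitrary: m \<xi> \<eta>)
  case 0
  then show ?case
    using assms by (simp add: classic_data_def field_simps)
next
  case (Suc n)
  show ?case
    unfolding steps_value.simps
  proof (rule cINF_greatest)
    fix f :: real
    define V where "V = (\<lambda>b. steps_value classic_data q r \<epsilon> n (shift m b)
      (\<xi> + \<epsilon> * sign b * (q m - r m)) (\<eta> + \<epsilon> * sign b * (q m + r m - 2 * f)))"
    have "\<epsilon> * walk_avg (\<lambda>m. q m - r m) (\<lambda>x. \<bar>x\<bar> / 2) n (shift m True) (\<xi> / \<epsilon> + (q m - r m))
        + (\<eta> + \<epsilon> * (q m + r m - 2 * f)) / 2 \<le> V True"
      using Suc[of "shift m True" "\<xi> + \<epsilon> * (q m - r m)" "\<eta> + \<epsilon> * (q m + r m - 2 * f)"] assms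
      by (simp add: V_def sign_def add_divide_distrib)
    moreover have "\<epsilon> * walk_avg (\<lambda>m. q m - r m) (\<lambda>x. \<bar>x\<bar> / 2) n (shift m False) (\<xi> / \<epsilon> - (q m - r m))
        + (\<eta> - \<epsilon> * (q m + r m - 2 * f)) / 2 \<le> V False"
      using Suc[of "shift m False" "\<xi> - \<epsilon> * (q m - r m)" "\<eta> - \<epsilon> * (q m + r m - 2 * f)"] assms
      by (simp add: V_def sign_def diff_divide_distrib)
    ultimately have "\<epsilon> * walk_avg (\<lambda>m. q m - r m) (\<lambda>x. \<bar>x\<bar> / 2) (Suc n) m (\<xi> / \<epsilon>) + \<eta> / 2
        \<le> (V True + V False) / 2"
      by (simp add: field_simps)
    also have "\<dots> \<le> max (V True) (V False)"
      by (simp add: max_def)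
    finally show "\<epsilon> * walk_avg (\<lambda>m. q m - r m) (\<lambda>x. \<bar>x\<bar> / 2) (Suc n) m (\<xi> / \<epsilon>) + \<eta> / 2
        \<le> (MAX b\<in>UNIV. steps_value classic_data q r \<epsilon> n (shift m b)
            (\<xi> + \<epsilon> * sign b * (q m - r m)) (\<eta> + \<epsilon> * sign b * (q m + r m - 2 * f)))"
      unfolding Max_bool V_def .
  qed simp
qed

text \<open>
  The investor equalizes the two outcomes. With \<open>A\<close> and \<open>B\<close> the values after \<open>+\<close> and \<open>-\<close>, this
  requires \<open>f = (q m + r m + A - B) / 2\<close>. As \<open>g\<close> has slope at most \<open>1/2\<close>, the difference
  \<open>A - B\<close> is at most \<open>\<bar>D m\<bar>\<close> plus the effect of the state, and the bounds on \<open>q\<close> and \<open>r\<close>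
  leave room for the latter, so \<open>f\<close> is admissible.
\<close>
lemma steps_value_le_walk_avg:
  fixes q r :: "bool list \<Rightarrow> real"
  defines "D \<equiv> \<lambda>m. q m - r m"
  assumes d: "d \<ge> 1" and \<epsilon>: "\<epsilon> > 0"
    and slack: "\<And>m. m \<in> states d \<Longrightarrow> \<bar>q m\<bar> + 4 * (real d + 1) * real d * L \<le> 1"
      "\<And>m. m \<in> states d \<Longrightarrow> \<bar>r m\<bar> + 4 * (real d + 1) * real d * L \<le> 1"
    and above: "\<And>x. \<bar>x\<bar> / 2 \<le> g x"
    and der: "\<And>x. (g has_real_derivative g' x) (at x)"
    and half: "\<And>x y. \<bar>g x - g y\<bar> \<le> 1 / 2 * \<bar>x - y\<bar>"
    and lip: "\<And>x y. \<bar>g' x - g' y\<bar> \<le> L * \<bar>x - y\<bar>"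
  shows "m \<in> states d \<Longrightarrow>
    steps_value classic_data q r \<epsilon> n m \<xi> \<eta> \<le> \<epsilon> * walk_avg D g n m (\<xi> / \<epsilon>) + \<eta> / 2"
proof (induction n arbitrary: m \<xi> \<eta>)
  case 0
  have "\<bar>\<xi>\<bar> / 2 \<le> \<epsilon> * g (\<xi> / \<epsilon>)"
    using mult_left_mono[OF above[of "\<xi> / \<epsilon>"], of \<epsilon>] \<epsilon> by (simp add: abs_mult)
  then show ?case
    by (simp add: classic_data_def add_divide_distrib)
next
  case (Suc n)
  have L: "0 \<le> L"
    using lip[of 1 0] by simp
  define A where "A = walk_avg D g n (shift m True) (\<xi> / \<epsilon> + D m)"
  define B where "B = walk_avg D g n (shift m False) (\<xi> / \<epsilon> - D m)"
  define f where "f = (q m + r m + A - B) / 2"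
  have f2: "q m + r m - 2 * f = B - A"
    by (simp add: f_def field_simps)
  have D2: "\<bar>D m\<bar> \<le> 2" if "m \<in> states d" for m
  proof -
    have "0 \<le> 4 * (real d + 1) * real d * L"
      using L by simp
    then show ?thesis
      using slack[OF that] unfolding D_def by linarith
  qed
  have AB: "\<bar>A - B\<bar> \<le> \<bar>D m\<bar> + 8 * (real d + 1) * real d * L"
  proof -
    have "\<bar>A - walk_avg D g n (shift m True) (\<xi> / \<epsilon> - D m)\<bar> \<le> 1 / 2 * \<bar>(\<xi> / \<epsilon> + D m) - (\<xi> / \<epsilon> - D m)\<bar>"
      unfolding A_def by (rule walk_avg_lipschitz[OF half])
    also have "\<dots> = \<bar>D m\<bar>"
      by simp
    finally have 1: "\<bar>A - walk_avg D g n (shift m True) (\<xi> / \<epsilon> - D m)\<bar> \<le> \<bar>D m\<bar>" .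
    have 2: "\<bar>walk_avg D g n (shift m True) (\<xi> / \<epsilon> - D m) - B\<bar> \<le> 8 * (real d + 1) * real d * L"
      unfolding B_def
      by (rule walk_avg_state_smooth[OF d D2 der lip])
        (use Suc.prems shift_in_states[OF d] in \<open>auto simp: states_def\<close>)
    show ?thesis
      using 1 2 by linarith
  qed
  have f: "f \<in> {-1..1}"
  proof -
    define e where "e = 4 * (real d + 1) * real d * L"
    have "\<bar>A - B\<bar> \<le> \<bar>q m - r m\<bar> + 2 * e"
      unfolding e_def using AB by (simp add: D_def algebra_simps)
    moreover have "\<bar>q m\<bar> + e \<le> 1" "\<bar>r m\<bar> + e \<le> 1"
      using slack[OF Suc.prems] unfolding e_def D_def by simp_all
    ultimately have "\<bar>q m + r m + A - B\<bar> \<le> 2"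
      by linarith
    then show ?thesis
      by (simp add: f_def abs_le_iff)
  qed
  have bdd: "bdd_below ((\<lambda>f. MAX b\<in>UNIV. steps_value classic_data q r \<epsilon> n (shift m b)
      (\<xi> + \<epsilon> * sign b * (q m - r m)) (\<eta> + \<epsilon> * sign b * (q m + r m - 2 * f))) ` {-1..1})"
    unfolding Max_bool
    by (intro bounded_imp_bdd_below compact_imp_bounded compact_continuous_image compact_Icc,
        subst (1 2) steps_value_translate, intro continuous_intros) auto
  have "steps_value classic_data q r \<epsilon> (Suc n) m \<xi> \<eta> \<le>
      (MAX b\<in>UNIV. steps_value classic_data q r \<epsilon> n (shift m b)
        (\<xi> + \<epsilon> * sign b * (q m - r m)) (\<eta> + \<epsilon> * sign b * (q m + r m - 2 * f)))"
    unfolding steps_value.simps by (rule cINF_lower[OF bdd f])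
  also have "\<dots> \<le> \<epsilon> * ((A + B) / 2) + \<eta> / 2"
    unfolding Max_bool
  proof (rule max.boundedI)
    have "steps_value classic_data q r \<epsilon> n (shift m True) (\<xi> + \<epsilon> * sign True * (q m - r m))
        (\<eta> + \<epsilon> * sign True * (q m + r m - 2 * f))
      \<le> \<epsilon> * A + (\<eta> + \<epsilon> * (B - A)) / 2"
      using Suc.IH[OF shift_in_states[OF d Suc.prems], of True "\<xi> + \<epsilon> * (q m - r m)"
          "\<eta> + \<epsilon> * (B - A)"] \<epsilon>
      by (simp add: f2 A_def sign_def add_divide_distrib D_def)
    then show "steps_value classic_data q r \<epsilon> n (shift m True) (\<xi> + \<epsilon> * sign True * (q m - r m))
        (\<eta> + \<epsilon> * sign True * (q m + r m - 2 * f)) \<le> \<epsilon> * ((A + B) / 2) + \<eta> / 2"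
      by (simp add: field_simps)
  next
    have "steps_value classic_data q r \<epsilon> n (shift m False) (\<xi> + \<epsilon> * sign False * (q m - r m))
        (\<eta> + \<epsilon> * sign False * (q m + r m - 2 * f))
      \<le> \<epsilon> * B + (\<eta> - \<epsilon> * (B - A)) / 2"
      using Suc.IH[OF shift_in_states[OF d Suc.prems], of False "\<xi> - \<epsilon> * (q m - r m)"
          "\<eta> - \<epsilon> * (B - A)"] \<epsilon>
      by (simp add: f2 B_def sign_def diff_divide_distrib D_def)
    then show "steps_value classic_data q r \<epsilon> n (shift m False) (\<xi> + \<epsilon> * sign False * (q m - r m))
        (\<eta> + \<epsilon> * sign False * (q m + r m - 2 * f)) \<le> \<epsilon> * ((A + B) / 2) + \<eta> / 2"
      by (simp add: field_simps)
  qed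
  finally show ?case
    by (simp add: A_def B_def)
qed

definition smooth_half_abs :: "real \<Rightarrow> real \<Rightarrow> real" where
  "smooth_half_abs \<Lambda> x = sqrt (x\<^sup>2 + \<Lambda>\<^sup>2) / 2"

lemma smooth_half_abs_bounds:
  assumes "\<Lambda> > 0"
  shows "\<bar>x\<bar> / 2 \<le> smooth_half_abs \<Lambda> x" "smooth_half_abs \<Lambda> x \<le> \<bar>x\<bar> / 2 + \<Lambda> / 2"
  using assms sqrt_sum_squares_le_sum_abs[of x \<Lambda>] real_sqrt_ge_abs1[of x \<Lambda>]
  by (simp_all add: smooth_half_abs_def)

lemma smooth_half_abs_DERIV:
  assumes "\<Lambda> > 0"
  shows "(smooth_half_abs \<Lambda> has_real_derivative x / (2 * sqrt (x\<^sup>2 + \<Lambda>\<^sup>2))) (at x)"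
proof -
  have "x\<^sup>2 + \<Lambda>\<^sup>2 > 0"
    using assms by (simp add: add_nonneg_pos)
  then show ?thesis
    unfolding smooth_half_abs_def[abs_def]
    by (auto intro!: derivative_eq_intros simp: field_simps)
qed

lemma lipschitz_from_DERIV:
  fixes F F' :: "real \<Rightarrow> real"
  assumes "\<And>x. (F has_real_derivative F' x) (at x)" "\<And>x. \<bar>F' x\<bar> \<le> L"
  shows "\<bar>F x - F y\<bar> \<le> L * \<bar>x - y\<bar>"
proof -
  have "norm (F x - F y) \<le> L * norm (x - y)"
    by (rule field_differentiable_bound[of UNIV F F']) (use assms in auto)
  then show ?thesis by simp
qed

lemma smooth_half_abs_lipschitz:
  assumes "\<Lambda> > 0"
  shows "\<bar>smooth_half_abs \<Lambda> x - smooth_half_abs \<Lambda> y\<bar> \<le> 1 / 2 * \<bar>x - y\<bar>"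
proof (rule lipschitz_from_DERIV[OF smooth_half_abs_DERIV[OF assms]])
  fix x
  have "x\<^sup>2 + \<Lambda>\<^sup>2 > 0"
    using assms by (simp add: add_nonneg_pos)
  then show "\<bar>x / (2 * sqrt (x\<^sup>2 + \<Lambda>\<^sup>2))\<bar> \<le> 1 / 2"
    using real_sqrt_ge_abs1[of x \<Lambda>] by (simp add: abs_divide field_simps)
qed

lemma smooth_half_abs_DERIV_lipschitz:
  assumes "\<Lambda> > 0"
  shows "\<bar>x / (2 * sqrt (x\<^sup>2 + \<Lambda>\<^sup>2)) - y / (2 * sqrt (y\<^sup>2 + \<Lambda>\<^sup>2))\<bar> \<le> 1 / (2 * \<Lambda>) * \<bar>x - y\<bar>"
proof (rule lipschitz_from_DERIV)
  fix x
  define R where "R = sqrt (x\<^sup>2 + \<Lambda>\<^sup>2)"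
  have pos: "x\<^sup>2 + \<Lambda>\<^sup>2 > 0"
    using assms by (simp add: add_nonneg_pos)
  have R: "R > 0" "R\<^sup>2 = x\<^sup>2 + \<Lambda>\<^sup>2" "\<Lambda> \<le> R"
    using pos assms real_sqrt_ge_abs2[of x \<Lambda>] by (auto simp: R_def)
  show "((\<lambda>x. x / (2 * sqrt (x\<^sup>2 + \<Lambda>\<^sup>2))) has_real_derivative \<Lambda>\<^sup>2 / (2 * sqrt (x\<^sup>2 + \<Lambda>\<^sup>2) ^ 3)) (at x)"
  proof -
    have "((\<lambda>x. x / (2 * sqrt (x\<^sup>2 + \<Lambda>\<^sup>2))) has_real_derivative
        (1 * (2 * R) - x * (2 * (2 * x * (inverse R / 2)))) / (2 * R * (2 * R))) (at x)"
      unfolding R_def using pos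
      by (auto intro!: derivative_eq_intros simp: power2_eq_square)
    also have "(1 * (2 * R) - x * (2 * (2 * x * (inverse R / 2)))) / (2 * R * (2 * R)) = (R\<^sup>2 - x\<^sup>2) / (2 * R ^ 3)"
      using R(1) by (simp add: field_simps power2_eq_square power3_eq_cube)
    also have "R\<^sup>2 - x\<^sup>2 = \<Lambda>\<^sup>2"
      using R by simp
    finally show ?thesis
      by (simp add: R_def)
  qed
  have "\<Lambda>\<^sup>2 * \<Lambda> \<le> R\<^sup>2 * R"
    using R assms by (intro mult_mono power_mono) auto
  then have "\<Lambda>\<^sup>2 / (2 * R ^ 3) \<le> 1 / (2 * \<Lambda>)"
    using R(1) assms by (simp add: divide_simps) (simp add: power2_eq_square power3_eq_cube)
  then show "\<bar>\<Lambda>\<^sup>2 / (2 * sqrt (x\<^sup>2 + \<Lambda>\<^sup>2) ^ 3)\<bar> \<le> 1 / (2 * \<Lambda>)"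
    unfolding R_def[symmetric] using R(1) by simp
qed

text \<open>
  There are finitely many states, so \<open>\<bar>q\<bar>\<close> and \<open>\<bar>r\<bar>\<close> stay below 1 by a uniform margin \<open>\<rho>\<close>, and
  \<open>\<Lambda>\<close> is chosen so that the effect of the state on the smoothed value uses up exactly this
  margin.
\<close>
lemma steps_value_near_walk_avg:
  assumes d: "d \<ge> 1"
    and q: "\<And>m. m \<in> states d \<Longrightarrow> \<bar>q m\<bar> < 1" and r: "\<And>m. m \<in> states d \<Longrightarrow> \<bar>r m\<bar> < 1"
  obtains K where "\<And>\<epsilon> n m \<xi> \<eta>. \<epsilon> > 0 \<Longrightarrow> m \<in> states d \<Longrightarrow>
    \<bar>steps_value classic_data q r \<epsilon> n m \<xi> \<eta>
      - (\<epsilon> * walk_avg (\<lambda>m. q m - r m) (\<lambda>x. \<bar>x\<bar> / 2) n m (\<xi> / \<epsilon>) + \<eta> / 2)\<bar> \<le> K * \<epsilon>"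
proof -
  define \<rho> where "\<rho> = Min ((\<lambda>m. min (1 - \<bar>q m\<bar>) (1 - \<bar>r m\<bar>)) ` states d)"
  have \<rho>: "0 < \<rho>"
    unfolding \<rho>_def using q r finite_states states_nonempty by (subst Min_gr_iff) auto
  have "\<rho> \<le> min (1 - \<bar>q m\<bar>) (1 - \<bar>r m\<bar>)" if "m \<in> states d" for m
    unfolding \<rho>_def using that finite_states by (intro Min_le) auto
  then have \<rho>_le: "\<bar>q m\<bar> + \<rho> \<le> 1" "\<bar>r m\<bar> + \<rho> \<le> 1" if "m \<in> states d" for m
    using that by fastforce+
  define \<Lambda> where "\<Lambda> = 2 * (real d + 1) * real d / \<rho>"
  have \<Lambda>: "\<Lambda> > 0" "4 * (real d + 1) * real d * (1 / (2 * \<Lambda>)) = \<rho>"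
  proof -
    define p where "p = real d * (real d + 1)"
    have "p > 0"
      using d by (simp add: p_def)
    then have p: "p > 0" "\<Lambda> = 2 * p / \<rho>" "4 * (real d + 1) * real d = 4 * p"
      by (simp_all add: \<Lambda>_def p_def algebra_simps)
    show "\<Lambda> > 0"
      using p \<rho> by simp
    show "4 * (real d + 1) * real d * (1 / (2 * \<Lambda>)) = \<rho>"
      unfolding p(3) p(2) using p(1) \<rho> by simp
  qed
  show thesis
  proof
    fix \<epsilon> n m \<xi> \<eta> assume \<epsilon>: "(\<epsilon>::real) > 0" and m: "m \<in> states d"
    let ?V = "walk_avg (\<lambda>m. q m - r m) (\<lambda>x. \<bar>x\<bar> / 2) n m (\<xi> / \<epsilon>)"
    have "steps_value classic_data q r \<epsilon> n m \<xi> \<eta>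
        \<le> \<epsilon> * walk_avg (\<lambda>m. q m - r m) (smooth_half_abs \<Lambda>) n m (\<xi> / \<epsilon>) + \<eta> / 2"
      by (rule steps_value_le_walk_avg[OF d \<epsilon> _ _ _ smooth_half_abs_DERIV smooth_half_abs_lipschitz
            smooth_half_abs_DERIV_lipschitz])
        (use \<Lambda> \<rho>_le m smooth_half_abs_bounds(1) in auto)
    also have "walk_avg (\<lambda>m. q m - r m) (smooth_half_abs \<Lambda>) n m (\<xi> / \<epsilon>)
        \<le> walk_avg (\<lambda>m. q m - r m) (\<lambda>x. \<bar>x\<bar> / 2 + \<Lambda> / 2) n m (\<xi> / \<epsilon>)"
      using smooth_half_abs_bounds(2)[OF \<Lambda>(1)] by (rule walk_avg_mono)
    also have "\<dots> = ?V + \<Lambda> / 2"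
      by (rule walk_avg_add_const)
    finally have "steps_value classic_data q r \<epsilon> n m \<xi> \<eta> \<le> \<epsilon> * (?V + \<Lambda> / 2) + \<eta> / 2"
      using \<epsilon> by simp
    moreover have "\<epsilon> * ?V + \<eta> / 2 \<le> steps_value classic_data q r \<epsilon> n m \<xi> \<eta>"
      by (rule steps_value_ge_walk_avg[OF \<epsilon>])
    ultimately show "\<bar>steps_value classic_data q r \<epsilon> n m \<xi> \<eta> - (\<epsilon> * ?V + \<eta> / 2)\<bar> \<le> \<Lambda> / 2 * \<epsilon>"
      by (simp add: algebra_simps)
  qed
qed

section \<open>Self-similar Gaussian functions\<close>

text \<open>
  Self-similar functions: \<open>s\<^sup>-\<^sup>j\<^sup>/\<^sup>2\<close> times a function of \<open>x / sqrt s\<close>. The family is closed under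
  both partial derivatives, each \<open>x\<close>-derivative raising \<open>j\<close> by 1 and each \<open>s\<close>-derivative by 2,
  so that the size of any derivative can be read off from its index.
\<close>
definition gauss_family :: "real poly \<Rightarrow> real \<Rightarrow> nat \<Rightarrow> real \<Rightarrow> real \<Rightarrow> real" where
  "gauss_family p l j s x = poly p (x / sqrt s) * exp (- l * (x / sqrt s)\<^sup>2) / sqrt s ^ j"

lemma poly_times_gauss_DERIV:
  fixes l :: real
  shows "((\<lambda>y. poly p y * exp (- l * y\<^sup>2)) has_real_derivative
    poly (pderiv p - [:0, 2 * l:] * p) y * exp (- l * y\<^sup>2)) (at y)"
  by (rule DERIV_cong, (rule derivative_eq_intros poly_DERIV refl)+) (simp add: algebra_simps)

lemma gauss_family_DERIV_x:
  assumes "s > 0"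
  shows "(gauss_family p l j s has_real_derivative
           gauss_family (pderiv p - [:0, 2 * l:] * p) l (Suc j) s x) (at x)"
proof -
  have "((\<lambda>x. x / sqrt s) has_real_derivative 1 / sqrt s) (at x)"
    by (rule DERIV_cdivide) (rule DERIV_ident)
  from DERIV_cdivide[OF DERIV_chain2[OF poly_times_gauss_DERIV this], of p l "sqrt s ^ j"]
  show ?thesis
    unfolding gauss_family_def[abs_def] by (simp add: mult_ac)
qed

lemma gauss_family_DERIV_s:
  assumes "s > 0"
  shows "((\<lambda>s. gauss_family p l j s x) has_real_derivative
           gauss_family (smult (- real j / 2) p - smult (1 / 2) (pCons 0 (pderiv p - [:0, 2 * l:] * p)))
             l (j + 2) s x) (at s)"
proof -
  define S where "S = sqrt s"
  have S: "S > 0" "s = S\<^sup>2"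
    using assms by (simp_all add: S_def)
  have dinv: "((\<lambda>s. x / sqrt s) has_real_derivative - (x / S / 2) / S\<^sup>2) (at s)"
  proof -
    have "((\<lambda>s. x / sqrt s) has_real_derivative - (x * (inverse S / 2)) / (S * S)) (at s)"
      unfolding S_def using assms by (auto intro!: derivative_eq_intros)
    then show ?thesis
      by (simp add: field_simps power2_eq_square)
  qed
  have dpow: "((\<lambda>s. inverse (sqrt s ^ j)) has_real_derivative - (real j / 2) / S ^ (j + 2)) (at s)"
  proof -
    have "((\<lambda>s. inverse (sqrt s ^ j)) has_real_derivative
        - (inverse (S ^ j) * (real j * (inverse S / 2 * S ^ (j - Suc 0))) * inverse (S ^ j))) (at s)"
      unfolding S_def using assms by (auto intro!: derivative_eq_intros)
    also have "- (inverse (S ^ j) * (real j * (inverse S / 2 * S ^ (j - Suc 0))) * inverse (S ^ j))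
        = - (real j / 2) / S ^ (j + 2)"
      using S(1) by (cases j) (simp_all add: field_simps)
    finally show ?thesis .
  qed
  have "((\<lambda>s. (poly p (x / sqrt s) * exp (- l * (x / sqrt s)\<^sup>2)) * inverse (sqrt s ^ j)) has_real_derivative
      (poly (pderiv p - [:0, 2 * l:] * p) (x / sqrt s) * exp (- l * (x / sqrt s)\<^sup>2)
        * (- (x / S / 2) / S\<^sup>2)) * inverse (sqrt s ^ j)
      + - (real j / 2) / S ^ (j + 2) * (poly p (x / sqrt s) * exp (- l * (x / sqrt s)\<^sup>2))) (at s)"
    by (rule DERIV_mult[OF DERIV_chain2[OF poly_times_gauss_DERIV dinv] dpow])
  moreover have "(poly (pderiv p - [:0, 2 * l:] * p) (x / sqrt s) * exp (- l * (x / sqrt s)\<^sup>2)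
        * (- (x / S / 2) / S\<^sup>2)) * inverse (sqrt s ^ j)
      + - (real j / 2) / S ^ (j + 2) * (poly p (x / sqrt s) * exp (- l * (x / sqrt s)\<^sup>2))
    = gauss_family (smult (- real j / 2) p - smult (1 / 2) (pCons 0 (pderiv p - [:0, 2 * l:] * p)))
             l (j + 2) s x"
  proof -
    define P E Q where "P = poly p (x / S)" and "E = exp (- l * (x / S)\<^sup>2)"
      and "Q = poly (pderiv p - [:0, 2 * l:] * p) (x / S)"
    show ?thesis
      unfolding gauss_family_def S_def[symmetric] poly_diff[of _ "smult _ _"] poly_smult poly_pCons
        P_def[symmetric] E_def[symmetric] Q_def[symmetric]
      using S(1) by (simp add: field_simps power_add power2_eq_square)
  qed
  moreover have "(\<lambda>s. gauss_family p l j s x) =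
      (\<lambda>s. (poly p (x / sqrt s) * exp (- l * (x / sqrt s)\<^sup>2)) * inverse (sqrt s ^ j))"
    unfolding gauss_family_def by (rule ext, rule divide_inverse)
  ultimately show ?thesis
    by (simp only:)
qed

text \<open>
  From \<open>u / (k + 1) \<le> exp (u / (k + 1))\<close> with \<open>u = l y\<^sup>2\<close>.
\<close>
lemma power_times_gauss_bounded:
  fixes y l :: real
  assumes "l > 0"
  shows "\<bar>y\<bar> ^ k * exp (- l * y\<^sup>2) \<le> 1 + real (Suc k) ^ k / l ^ k"
proof (cases "\<bar>y\<bar> \<le> 1")
  case True
  have "\<bar>y\<bar> ^ k * exp (- l * y\<^sup>2) \<le> 1 * 1"
    using True assms by (intro mult_mono) (auto simp: power_le_one)
  then show ?thesis
    using assms by (simp add: add_increasing2)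
next
  case False
  have "\<bar>y\<bar> ^ k \<le> \<bar>y\<bar> ^ (2 * k)"
    using False by (intro power_increasing) auto
  also have "\<dots> = (l * y\<^sup>2) ^ k / l ^ k"
    using assms by (simp add: power_mult_distrib power_mult)
  also have "\<dots> \<le> real (Suc k) ^ k * exp (l * y\<^sup>2) / l ^ k"
  proof -
    define u where "u = l * y\<^sup>2"
    have u: "u \<ge> 0"
      using assms by (simp add: u_def)
    have "(u / Suc k) ^ k \<le> exp (u / Suc k) ^ k"
    proof (rule power_mono)
      show "u / Suc k \<le> exp (u / Suc k)"
        using exp_ge_add_one_self[of "u / Suc k"] by linarith
    qed (use u in simp)
    also have "\<dots> \<le> exp (u / Suc k) ^ Suc k"
      using u by (intro power_increasing) auto
    also have "\<dots> = exp u"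
      unfolding exp_of_nat_mult[symmetric] by simp
    finally have "u ^ k / real (Suc k) ^ k \<le> exp u"
      by (simp only: power_divide)
    then have "u ^ k \<le> real (Suc k) ^ k * exp u"
      by (simp only: pos_divide_le_eq zero_less_power of_nat_0_less_iff zero_less_Suc mult.commute)
    then show ?thesis
      unfolding u_def[symmetric] using assms by (intro divide_right_mono) auto
  qed
  finally have "\<bar>y\<bar> ^ k * exp (- l * y\<^sup>2) \<le> (real (Suc k) ^ k * exp (l * y\<^sup>2) / l ^ k) * exp (- l * y\<^sup>2)"
    by (intro mult_right_mono) auto
  also have "\<dots> = real (Suc k) ^ k / l ^ k"
    by (simp add: exp_minus field_simps)
  finally show ?thesis
    by simp
qed

lemma poly_times_gauss_bounded:
  fixes p :: "real poly" and l :: real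
  assumes "l > 0"
  obtains K where "K \<ge> 0" "\<And>y. \<bar>poly p y * exp (- l * y\<^sup>2)\<bar> \<le> K"
proof
  let ?K = "\<Sum>k\<le>degree p. \<bar>coeff p k\<bar> * (1 + real (Suc k) ^ k / l ^ k)"
  show "?K \<ge> 0"
    using assms by (intro sum_nonneg mult_nonneg_nonneg add_nonneg_nonneg) auto
  fix y
  have "\<bar>poly p y * exp (- l * y\<^sup>2)\<bar> \<le> (\<Sum>k\<le>degree p. \<bar>coeff p k * y ^ k * exp (- l * y\<^sup>2)\<bar>)"
    unfolding poly_altdef sum_distrib_right by (rule sum_abs)
  also have "\<dots> = (\<Sum>k\<le>degree p. \<bar>coeff p k\<bar> * (\<bar>y\<bar> ^ k * exp (- l * y\<^sup>2)))"
    by (simp add: abs_mult power_abs mult_ac)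
  also have "\<dots> \<le> ?K"
    using power_times_gauss_bounded[OF assms] by (intro sum_mono mult_left_mono) auto
  finally show "\<bar>poly p y * exp (- l * y\<^sup>2)\<bar> \<le> ?K" .
qed

lemma gauss_family_bound:
  assumes "l > 0"
  obtains K where "K \<ge> 0" "\<And>s x. s > 0 \<Longrightarrow> \<bar>gauss_family p l j s x\<bar> \<le> K / sqrt s ^ j"
proof -
  obtain K where K: "K \<ge> 0" "\<And>y. \<bar>poly p y * exp (- l * y\<^sup>2)\<bar> \<le> K"
    using poly_times_gauss_bounded[OF assms] by blast
  show thesis
  proof
    show "\<bar>gauss_family p l j s x\<bar> \<le> K / sqrt s ^ j" if "s > 0" for s x
      using that K(2)[of "x / sqrt s"] 
      by (simp add: gauss_family_def abs_divide divide_right_mono)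
  qed (rule K(1))
qed

text \<open>
  Giving up part of the exponent pays for the polynomial factor and keeps a Gaussian in the
  bound.
\<close>
lemma gauss_family_bound_gauss:
  assumes "l > l'"
  obtains K where "K \<ge> 0"
    "\<And>s x. s > 0 \<Longrightarrow> \<bar>gauss_family p l j s x\<bar> \<le> K * gauss_family 1 l' j s x"
proof -
  obtain K where K: "K \<ge> 0" "\<And>y. \<bar>poly p y * exp (- (l - l') * y\<^sup>2)\<bar> \<le> K"
    using poly_times_gauss_bounded[of "l - l'" p] assms by auto
  show thesis
  proof
    fix s x :: real assume s: "s > 0"
    define y where "y = x / sqrt s"
    have "poly p y * exp (- l * y\<^sup>2) = poly p y * exp (- (l - l') * y\<^sup>2) * exp (- l' * y\<^sup>2)"
      by (simp add: mult.assoc flip: exp_add) (simp add: algebra_simps)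
    then have "\<bar>poly p y * exp (- l * y\<^sup>2)\<bar> \<le> K * exp (- l' * y\<^sup>2)"
      using K(2)[of y] by (simp only: abs_mult abs_exp_cancel) (simp add: mult_right_mono)
    then show "\<bar>gauss_family p l j s x\<bar> \<le> K * gauss_family 1 l' j s x"
      using s by (simp add: gauss_family_def y_def abs_divide divide_right_mono)
  qed (rule K(1))
qed

section \<open>The solution of the heat equation with data half the absolute value\<close>

definition gauss_abs :: "real \<Rightarrow> real \<Rightarrow> real" where
  "gauss_abs a x = 1 / 2 * (LINT z|lborel. \<bar>x + a * z\<bar> * std_normal_density z)"

lemma heat_solution_eq_gauss_abs: "heat_solution C T t \<xi> = gauss_abs (sqrt (C * (T - t))) \<xi>"
  by (simp add: heat_solution_def gauss_abs_def)

lemma integrable_gauss_abs: "integrable lborel (\<lambda>z. \<bar>x + a * z\<bar> * std_normal_density z)"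
proof (rule Bochner_Integration.integrable_bound)
  show "integrable lborel (\<lambda>z. \<bar>x\<bar> * std_normal_density z + \<bar>a\<bar> * (std_normal_density z * \<bar>z\<bar>))"
    using integrable_std_normal_moment_abs[of 1] by simp
  have "\<bar>x + a * z\<bar> * std_normal_density z
      \<le> \<bar>x\<bar> * std_normal_density z + \<bar>a\<bar> * (std_normal_density z * \<bar>z\<bar>)" for z
  proof -
    have "\<bar>x + a * z\<bar> * std_normal_density z \<le> (\<bar>x\<bar> + \<bar>a\<bar> * \<bar>z\<bar>) * std_normal_density z"
      by (intro mult_right_mono) (auto simp flip: abs_mult)
    then show ?thesis
      by (simp add: algebra_simps)
  qed
  then show "AE z in lborel. norm (\<bar>x + a * z\<bar> * std_normal_density z)
      \<le> norm (\<bar>x\<bar> * std_normal_density z + \<bar>a\<bar> * (std_normal_density z * \<bar>z\<bar>))"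
    by (intro AE_I2) (simp add: abs_mult)
qed simp

lemma gauss_abs_zero: "gauss_abs 0 x = \<bar>x\<bar> / 2"
  by (simp add: gauss_abs_def)

lemma gauss_abs_scale:
  assumes "c > 0"
  shows "gauss_abs (c * a) (c * x) = c * gauss_abs a x"
proof -
  have "\<bar>c * x + c * a * z\<bar> = c * \<bar>x + a * z\<bar>" for z
    using assms by (simp add: mult.assoc abs_mult flip: distrib_left)
  then show ?thesis
    by (simp add: gauss_abs_def mult.assoc)
qed

text \<open>
  By the symmetry of the normal density, \<open>\<bar>x + a z\<bar>\<close> may be replaced by the mean of
  \<open>\<bar>x + a z\<bar>\<close> and \<open>\<bar>x - a z\<bar>\<close>, which is \<open>max \<bar>x\<bar> \<bar>a z\<bar>\<close>.
\<close>
lemma gauss_abs_mono: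
  assumes "0 \<le> a" "a \<le> b"
  shows "gauss_abs a x \<le> gauss_abs b x"
proof -
  have sym: "2 * (LINT z|lborel. \<bar>x + c * z\<bar> * std_normal_density z) =
      (LINT z|lborel. (\<bar>x + c * z\<bar> + \<bar>x - c * z\<bar>) * std_normal_density z)" for c
  proof -
    have "(LINT z|lborel. \<bar>x + c * z\<bar> * std_normal_density z) =
        (LINT z|lborel. \<bar>x - c * z\<bar> * std_normal_density z)"
      using lborel_integral_real_affine[of "-1" "\<lambda>z. \<bar>x + c * z\<bar> * std_normal_density z" 0]
      by (simp add: std_normal_density_def)
    then show ?thesis
      using integrable_gauss_abs[of x c] integrable_gauss_abs[of x "- c"]
      by (simp add: distrib_right)
  qed
  have "(LINT z|lborel. (\<bar>x + a * z\<bar> + \<bar>x - a * z\<bar>) * std_normal_density z)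
      \<le> (LINT z|lborel. (\<bar>x + b * z\<bar> + \<bar>x - b * z\<bar>) * std_normal_density z)"
  proof (rule integral_mono)
    fix z :: real
    have "\<bar>a * z\<bar> \<le> \<bar>b * z\<bar>"
      using assms by (simp add: abs_mult mult_right_mono)
    then have "\<bar>x + a * z\<bar> + \<bar>x - a * z\<bar> \<le> \<bar>x + b * z\<bar> + \<bar>x - b * z\<bar>"
      by linarith
    then show "(\<bar>x + a * z\<bar> + \<bar>x - a * z\<bar>) * std_normal_density z
        \<le> (\<bar>x + b * z\<bar> + \<bar>x - b * z\<bar>) * std_normal_density z"
      by (intro mult_right_mono) auto
  qed (use integrable_gauss_abs[of x a] integrable_gauss_abs[of x "- a"]
      integrable_gauss_abs[of x b] integrable_gauss_abs[of x "- b"] in \<open>simp_all add: distrib_right\<close>)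
  then show ?thesis
    unfolding sym[symmetric] by (simp add: gauss_abs_def)
qed

lemma gauss_abs_lipschitz: "\<bar>gauss_abs a x - gauss_abs b x\<bar> \<le> \<bar>a - b\<bar>"
proof -
  have "\<bar>(LINT z|lborel. \<bar>x + a * z\<bar> * std_normal_density z) - (LINT z|lborel. \<bar>x + b * z\<bar> * std_normal_density z)\<bar>
      = \<bar>LINT z|lborel. \<bar>x + a * z\<bar> * std_normal_density z - \<bar>x + b * z\<bar> * std_normal_density z\<bar>"
    by (subst Bochner_Integration.integral_diff) (simp_all add: integrable_gauss_abs)
  also have "\<dots> \<le> (LINT z|lborel. \<bar>\<bar>x + a * z\<bar> * std_normal_density z - \<bar>x + b * z\<bar> * std_normal_density z\<bar>)"
    by (rule integral_abs_bound)
  also have "\<dots> \<le> (LINT z|lborel. \<bar>a - b\<bar> * (std_normal_density z * \<bar>z\<bar>))"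
  proof (rule integral_mono)
    fix z :: real
    have "\<bar>\<bar>x + a * z\<bar> - \<bar>x + b * z\<bar>\<bar> \<le> \<bar>(x + a * z) - (x + b * z)\<bar>"
      by (rule abs_triangle_ineq3)
    also have "\<dots> = \<bar>a - b\<bar> * \<bar>z\<bar>"
      by (simp add: algebra_simps flip: abs_mult)
    finally have "\<bar>\<bar>x + a * z\<bar> - \<bar>x + b * z\<bar>\<bar> * std_normal_density z \<le> \<bar>a - b\<bar> * \<bar>z\<bar> * std_normal_density z"
      by (intro mult_right_mono) auto
    moreover have "\<bar>x + a * z\<bar> * std_normal_density z - \<bar>x + b * z\<bar> * std_normal_density z
        = (\<bar>x + a * z\<bar> - \<bar>x + b * z\<bar>) * std_normal_density z"
      by (simp add: left_diff_distrib)
    ultimately show "\<bar>\<bar>x + a * z\<bar> * std_normal_density z - \<bar>x + b * z\<bar> * std_normal_density z\<bar>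
        \<le> \<bar>a - b\<bar> * (std_normal_density z * \<bar>z\<bar>)"
      by (simp add: abs_mult mult_ac)
  qed (use integrable_gauss_abs integrable_std_normal_moment_abs[of 1] in simp_all)
  also have "\<dots> = \<bar>a - b\<bar> * sqrt (2 / pi)"
    using integral_std_normal_moment_abs_odd[of 0] by simp
  also have "\<dots> \<le> \<bar>a - b\<bar> * 1"
    using pi_ge_two by (intro mult_left_mono) (auto simp: real_sqrt_le_1_iff)
  finally show ?thesis
    by (simp add: gauss_abs_def)
qed

definition normal_primitive :: "real \<Rightarrow> real" where
  "normal_primitive y = (LBINT z=0..y. std_normal_density z)"

lemma std_normal_density_le: "std_normal_density y \<le> inverse (1 + y\<^sup>2)"
proof -
  have "2 \<le> sqrt (2 * pi)"
    using pi_ge_two by (intro real_le_rsqrt) (simp add: power2_eq_square)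
  then have "1 / sqrt (2 * pi) \<le> 1 / 2"
    by (intro divide_left_mono) auto
  moreover have "exp (- y\<^sup>2 / 2) \<le> 1 / (1 + y\<^sup>2 / 2)"
    using exp_ge_add_one_self[of "y\<^sup>2 / 2"]
    by (simp add: exp_minus inverse_eq_divide frac_le add_pos_nonneg)
  ultimately have "std_normal_density y \<le> 1 / 2 * (1 / (1 + y\<^sup>2 / 2))"
    unfolding std_normal_density_def by (intro mult_mono) auto
  also have "\<dots> = 1 / (2 + y\<^sup>2)"
    by (simp add: field_simps)
  also have "\<dots> \<le> 1 / (1 + y\<^sup>2)"
    by (intro frac_le) (auto intro: add_pos_nonneg)
  finally show ?thesis
    by (simp add: inverse_eq_divide)
qed

lemma std_normal_density_DERIV:
  "(std_normal_density has_real_derivative - (y * std_normal_density y)) (at y)"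
proof -
  have "((\<lambda>y::real. exp (- y\<^sup>2 / 2)) has_real_derivative - (y * exp (- y\<^sup>2 / 2))) (at y)"
    by (auto intro!: derivative_eq_intros)
  from DERIV_cmult[OF this, of "1 / sqrt (2 * pi)"] show ?thesis
    unfolding std_normal_density_def[abs_def] by (simp add: mult_ac)
qed

lemma normal_primitive_DERIV:
  "(normal_primitive has_real_derivative std_normal_density y) (at y)"
proof -
  let ?a = "- \<bar>y\<bar> - 1" and ?b = "\<bar>y\<bar> + 1"
  have "((\<lambda>u. LBINT z=(0::real)..u. std_normal_density z) has_vector_derivative std_normal_density y)
      (at y within {?a..?b})"
    by (rule interval_integral_FTC2)
      (auto intro!: continuous_at_imp_continuous_on DERIV_isCont[OF std_normal_density_DERIV])
  moreover have "at y within {?a..?b} = at y"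
    by (intro at_within_interior) auto
  ultimately show ?thesis
    by (simp add: normal_primitive_def[abs_def] has_real_derivative_iff_has_vector_derivative zero_ereal_def)
qed

lemma normal_primitive_mono: "x \<le> y \<Longrightarrow> normal_primitive x \<le> normal_primitive y"
  by (rule DERIV_nonneg_imp_nondecreasing[of x y]) (auto intro!: exI normal_primitive_DERIV)

lemma normal_primitive_zero: "normal_primitive 0 = 0"
  by (simp add: normal_primitive_def zero_ereal_def[symmetric])

lemma normal_primitive_uminus: "normal_primitive (- y) = - normal_primitive y"
proof -
  have "((\<lambda>y. normal_primitive y + normal_primitive (- y)) has_real_derivative
      std_normal_density y + std_normal_density (- y) * - 1) (at y)" for y
    by (intro DERIV_add normal_primitive_DERIV DERIV_chain2[OF normal_primitive_DERIV])
      (auto intro!: derivative_eq_intros)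
  then have "\<forall>y. ((\<lambda>y. normal_primitive y + normal_primitive (- y)) has_real_derivative 0) (at y)"
    by (simp add: std_normal_density_def)
  from DERIV_isconst_all[OF this, of y 0] show ?thesis
    by (simp add: normal_primitive_zero)
qed

text \<open>
  An increasing bounded function converges; boundedness comes from comparing derivatives with
  the arctangent.
\<close>
lemma normal_primitive_tendsto:
  obtains L where "(normal_primitive \<longlongrightarrow> L) at_top"
proof
  have bound: "normal_primitive y \<le> pi / 2" for y
  proof -
    have "normal_primitive y \<le> normal_primitive \<bar>y\<bar>"
      by (rule normal_primitive_mono) simp
    also have "arctan 0 - normal_primitive 0 \<le> arctan \<bar>y\<bar> - normal_primitive \<bar>y\<bar>"
      by (rule DERIV_nonneg_imp_nondecreasing)
        (auto intro!: exI conjI DERIV_diff DERIV_arctan normal_primitive_DERIV simp: std_normal_density_le)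
    then have "normal_primitive \<bar>y\<bar> \<le> arctan \<bar>y\<bar>"
      by (simp add: normal_primitive_zero)
    also have "arctan \<bar>y\<bar> \<le> pi / 2"
      using arctan_ubound[of "\<bar>y\<bar>"] by simp
    finally show ?thesis .
  qed
  have bdd: "bdd_above (range normal_primitive)"
    using bound by (intro bdd_aboveI[of _ "pi / 2"]) auto
  show "(normal_primitive \<longlongrightarrow> (SUP y. normal_primitive y)) at_top"
  proof (rule increasing_tendsto)
    show "\<forall>\<^sub>F y in at_top. normal_primitive y \<le> (SUP y. normal_primitive y)"
      by (intro always_eventually allI cSUP_upper bdd) simp
    fix c assume "c < (SUP y. normal_primitive y)"
    then obtain y where y: "c < normal_primitive y"
      using less_cSUP_iff[OF _ bdd] by auto
    show "\<forall>\<^sub>F z in at_top. c < normal_primitive z"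
      using eventually_ge_at_top[of y] by eventually_elim (use y normal_primitive_mono in force)
  qed
qed

lemma std_normal_density_tendsto: "(std_normal_density \<longlongrightarrow> 0) at_top"
proof -
  have "((\<lambda>y::real. exp (- y\<^sup>2 / 2)) \<longlongrightarrow> 0) at_top"
    by real_asymp
  then show ?thesis
    unfolding std_normal_density_def[abs_def] by (rule tendsto_mult_right_zero)
qed

text \<open>
  Split the integral at the zero \<open>-y\<close> of \<open>y + z\<close> and reflect the negative part. Both parts
  become integrals of \<open>(z - a) * std_normal_density z\<close> over \<open>{a..}\<close>, which has the primitive \<open>G a\<close>.
\<close>
lemma gauss_abs_one: "gauss_abs 1 y = y * normal_primitive y + std_normal_density y"
proof -
  obtain L where L: "(normal_primitive \<longlongrightarrow> L) at_top"
    by (rule normal_primitive_tendsto)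
  define R where "R a z = ennreal ((z - a) * std_normal_density z) * indicator {a..} z" for a z :: real
  define G where "G a z = - std_normal_density z - a * normal_primitive z" for a z :: real
  have G_DERIV: "(G a has_real_derivative (z - a) * std_normal_density z) (at z)" for a z
    unfolding G_def[abs_def]
    by (rule derivative_eq_intros std_normal_density_DERIV normal_primitive_DERIV refl)+
      (simp add: algebra_simps)
  have G_lim: "(G a \<longlongrightarrow> - (a * L)) at_top" for a
    using tendsto_diff[OF tendsto_minus[OF std_normal_density_tendsto] tendsto_mult_left[OF L, of a]]
    unfolding G_def[abs_def] by simp
  have R: "(\<integral>\<^sup>+z. R a z \<partial>lborel) = ennreal (- (a * L) - G a a)" for a
    unfolding R_def by (rule nn_integral_FTC_atLeast) (use G_DERIV G_lim in auto)
  have G_le: "G a a \<le> - (a * L)" for a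
  proof (rule tendsto_lowerbound[OF G_lim])
    show "\<forall>\<^sub>F z in at_top. G a a \<le> G a z"
      using eventually_ge_at_top[of a]
      by eventually_elim (rule DERIV_nonneg_imp_nondecreasing, auto intro!: exI G_DERIV)
  qed simp
  have "(\<integral>\<^sup>+z. ennreal (\<bar>y + 1 * z\<bar> * std_normal_density z) \<partial>lborel) = (\<integral>\<^sup>+z. R (- y) z + R y (- z) \<partial>lborel)"
  proof (rule nn_integral_cong)
    fix z :: real
    have "std_normal_density (- z) = std_normal_density z"
      by (simp add: std_normal_density_def)
    then show "ennreal (\<bar>y + 1 * z\<bar> * std_normal_density z) = R (- y) z + R y (- z)"
      unfolding R_def by (cases z "- y" rule: linorder_cases) (auto simp: indicator_def algebra_simps intro!: arg_cong[of _ _ ennreal])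
  qed
  also have "\<dots> = (\<integral>\<^sup>+z. R (- y) z \<partial>lborel) + (\<integral>\<^sup>+z. R y (- z) \<partial>lborel)"
    unfolding R_def by (intro nn_integral_add) auto
  also have "(\<integral>\<^sup>+z. R y (- z) \<partial>lborel) = (\<integral>\<^sup>+z. R y z \<partial>lborel)"
  proof -
    have "R y \<in> borel_measurable borel"
      unfolding R_def by measurable
    from nn_integral_real_affine[OF this, of "-1" 0] show ?thesis
      by simp
  qed
  also have "(\<integral>\<^sup>+z. R (- y) z \<partial>lborel) + (\<integral>\<^sup>+z. R y z \<partial>lborel)
      = ennreal ((y * L - G (- y) (- y)) + (- (y * L) - G y y))"
    unfolding R by (subst ennreal_plus) (use G_le[of "- y"] G_le[of y] in simp_all)
  also have "(y * L - G (- y) (- y)) + (- (y * L) - G y y) = 2 * (y * normal_primitive y + std_normal_density y)"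
    by (simp add: G_def normal_primitive_uminus std_normal_density_def)
  finally have "(\<integral>\<^sup>+z. ennreal (\<bar>y + 1 * z\<bar> * std_normal_density z) \<partial>lborel)
      = ennreal (2 * (y * normal_primitive y + std_normal_density y))" .
  moreover have "0 \<le> y * normal_primitive y"
    using normal_primitive_mono[of 0 y] normal_primitive_mono[of y 0]
    by (cases "0 \<le> y") (auto simp: normal_primitive_zero intro: mult_nonpos_nonpos)
  then have "0 \<le> 2 * (y * normal_primitive y + std_normal_density y)"
    by simp
  moreover have "(LINT z|lborel. \<bar>y + 1 * z\<bar> * std_normal_density z)
      = enn2real (\<integral>\<^sup>+z. ennreal (\<bar>y + 1 * z\<bar> * std_normal_density z) \<partial>lborel)"
    by (subst integral_eq_nn_integral) auto
  ultimately have "(LINT z|lborel. \<bar>y + 1 * z\<bar> * std_normal_density z) = 2 * (y * normal_primitive y + std_normal_density y)"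
    by (simp only: enn2real_ennreal)
  then show ?thesis
    by (simp add: gauss_abs_def)
qed

lemma gauss_abs_sqrt:
  assumes "s > 0"
  shows "gauss_abs (sqrt s) x = sqrt s * gauss_abs 1 (x / sqrt s)"
  using gauss_abs_scale[of "sqrt s" 1 "x / sqrt s"] assms by simp

text \<open>
  The second derivative in \<open>x\<close> of \<open>gauss_abs (sqrt s) x\<close>, that is, the centred normal density
  with variance \<open>s\<close>.
\<close>
definition heat_curvature :: "real \<Rightarrow> real \<Rightarrow> real" where
  "heat_curvature = gauss_family [:1 / sqrt (2 * pi):] (1 / 2) 1"

lemma heat_curvature_eq: "heat_curvature s x = std_normal_density (x / sqrt s) / sqrt s"
  by (simp add: heat_curvature_def gauss_family_def std_normal_density_def)

lemma gauss_abs_one_DERIV: "(gauss_abs 1 has_real_derivative normal_primitive y) (at y)"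
  unfolding gauss_abs_one[abs_def]
  by (rule derivative_eq_intros std_normal_density_DERIV normal_primitive_DERIV refl)+
    (simp add: algebra_simps)

lemma gauss_abs_DERIV_x:
  assumes "s > 0"
  shows "(gauss_abs (sqrt s) has_real_derivative normal_primitive (x / sqrt s)) (at x)"
proof -
  have "((\<lambda>x. x / sqrt s) has_real_derivative 1 / sqrt s) (at x)"
    by (rule DERIV_cdivide) (rule DERIV_ident)
  from DERIV_cmult[OF DERIV_chain2[OF gauss_abs_one_DERIV this], of "sqrt s"] assms
  show ?thesis
    by (simp add: gauss_abs_sqrt[OF assms, abs_def])
qed

lemma normal_primitive_DERIV_x:
  assumes "s > 0"
  shows "((\<lambda>x. normal_primitive (x / sqrt s)) has_real_derivative heat_curvature s x) (at x)"
proof -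
  have "((\<lambda>x. x / sqrt s) has_real_derivative 1 / sqrt s) (at x)"
    by (rule DERIV_cdivide) (rule DERIV_ident)
  from DERIV_chain2[OF normal_primitive_DERIV this]
  show ?thesis
    by (simp add: heat_curvature_eq)
qed

text \<open>
  The heat equation for \<open>gauss_abs (sqrt s) x\<close>.
\<close>
lemma gauss_abs_DERIV_s:
  assumes "s > 0"
  shows "((\<lambda>s. gauss_abs (sqrt s) x) has_real_derivative heat_curvature s x / 2) (at s)"
proof -
  define S where "S = sqrt s"
  have S: "S > 0"
    using assms by (simp add: S_def)
  have dS: "(sqrt has_real_derivative inverse S / 2) (at s)"
    unfolding S_def using assms by (rule DERIV_real_sqrt)
  have "((\<lambda>s. x / sqrt s) has_real_derivative (0 * S - x * (inverse S / 2)) / (S * S)) (at s)"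
    unfolding S_def by (rule DERIV_divide[OF DERIV_const dS[unfolded S_def]]) (use assms in simp)
  from DERIV_mult[OF dS DERIV_chain2[OF gauss_abs_one_DERIV this]]
  have "((\<lambda>s. sqrt s * gauss_abs 1 (x / sqrt s)) has_real_derivative
      inverse S / 2 * gauss_abs 1 (x / S)
      + normal_primitive (x / S) * ((0 * S - x * (inverse S / 2)) / (S * S)) * S) (at s)"
    by (simp only: S_def)
  moreover have "inverse S / 2 * gauss_abs 1 (x / S)
      + normal_primitive (x / S) * ((0 * S - x * (inverse S / 2)) / (S * S)) * S = heat_curvature s x / 2"
    unfolding gauss_abs_one heat_curvature_eq S_def[symmetric] using S by (simp add: field_simps)
  ultimately have "((\<lambda>s. sqrt s * gauss_abs 1 (x / sqrt s)) has_real_derivative heat_curvature s x / 2) (at s)"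
    by (simp only:)
  then show ?thesis
    by (rule has_field_derivative_transform_within_open[of _ _ _ "{0<..}"])
      (use assms in \<open>auto simp: gauss_abs_sqrt\<close>)
qed

section \<open>Correctors and comparison for the averaged walk\<close>

definition state_avg :: "(bool list \<Rightarrow> real) \<Rightarrow> bool list \<Rightarrow> real" where
  "state_avg f m = (f (shift m True) + f (shift m False)) / 2"

text \<open>
  After \<open>j\<close> random steps the \<open>j\<close> oldest entries have been forgotten.
\<close>
lemma funpow_state_avg_cong:
  "j \<le> d \<Longrightarrow> m \<in> states d \<Longrightarrow> m' \<in> states d \<Longrightarrow> drop j m = drop j m' \<Longrightarrow>
     (state_avg ^^ j) f m = (state_avg ^^ j) f m'"
proof (induction j arbitrary: m m')
  case (Suc j)
  then have "(state_avg ^^ j) f (shift m b) = (state_avg ^^ j) f (shift m' b)" for b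
    by (intro Suc.IH drop_shift[of j d]) (auto intro!: shift_in_states)
  then show ?case
    by (simp add: state_avg_def[of "(state_avg ^^ j) f"])
qed simp

lemma sum_state_avg:
  assumes "d \<ge> 1"
  shows "(\<Sum>m\<in>states d. state_avg f m) = (\<Sum>m\<in>states d. f m)"
proof -
  have "state_avg f m = (f (twist True m) + f (twist False m)) / 2" for m
    by (cases "hd m") (simp_all add: state_avg_def twist_def)
  then have "(\<Sum>m\<in>states d. state_avg f m)
      = ((\<Sum>m\<in>states d. f (twist True m)) + (\<Sum>m\<in>states d. f (twist False m))) / 2"
    by (simp only: sum.distrib flip: sum_divide_distrib)
  then show ?thesis
    using sum.reindex_bij_betw[OF bij_betw_twist[OF assms], of f True]
      sum.reindex_bij_betw[OF bij_betw_twist[OF assms], of f False] by simp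
qed

lemma funpow_state_avg_eq_mean:
  assumes "d \<ge> 1" "m \<in> states d"
  shows "(state_avg ^^ d) f m = state_mean d f"
proof -
  have "(\<Sum>m'\<in>states d. (state_avg ^^ d) f m') = (\<Sum>m'\<in>states d. (state_avg ^^ d) f m)"
    using assms(2) by (intro sum.cong funpow_state_avg_cong) (simp_all add: states_def)
  moreover have "(\<Sum>m'\<in>states d. (state_avg ^^ j) f m') = (\<Sum>m'\<in>states d. f m')" for j
    by (induction j) (simp_all add: sum_state_avg[OF assms(1)])
  ultimately show ?thesis
    using card_states_pos[of d] by (simp add: state_mean_def field_simps)
qed

text \<open>
  The Neumann series stops after \<open>d\<close> terms, since \<open>d\<close> steps erase the initial state.
\<close>
lemma poisson_solution:
  assumes "d \<ge> 1"
  obtains \<gamma> where "\<And>m. m \<in> states d \<Longrightarrow> \<gamma> m - state_avg \<gamma> m = f m - state_mean d f"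
proof
  define \<gamma> where "\<gamma> m = (\<Sum>j<d. (state_avg ^^ j) f m)" for m
  fix m assume m: "m \<in> states d"
  have "state_avg \<gamma> m = (\<Sum>j<d. (state_avg ^^ Suc j) f m)"
    by (simp add: \<gamma>_def state_avg_def sum.distrib flip: sum_divide_distrib)
  then have "\<gamma> m - state_avg \<gamma> m = (\<Sum>j<d. (state_avg ^^ j) f m - (state_avg ^^ Suc j) f m)"
    by (simp only: \<gamma>_def sum_subtractf)
  also have "\<dots> = (state_avg ^^ 0) f m - (state_avg ^^ d) f m"
    by (rule sum_lessThan_telescope')
  finally show "\<gamma> m - state_avg \<gamma> m = f m - state_mean d f"
    using funpow_state_avg_eq_mean[OF assms m] by simp
qed

definition step_avg ::
  "(bool list \<Rightarrow> real) \<Rightarrow> (bool list \<Rightarrow> real \<Rightarrow> real) \<Rightarrow> bool list \<Rightarrow> real \<Rightarrow> real" where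
  "step_avg D F m x = (F (shift m True) (x + D m) + F (shift m False) (x - D m)) / 2"

text \<open>
  Discrete maximum principle: \<open>B\<close> is a supersolution whose surplus in each step dominates the
  defect of \<open>G\<close> in the averaging equation.
\<close>
lemma walk_avg_comparison:
  assumes d: "d \<ge> 1"
    and init: "\<And>m x. m \<in> states d \<Longrightarrow> \<bar>g x - G 0 m x\<bar> \<le> B 0 m x + K"
    and step: "\<And>n m x. m \<in> states d \<Longrightarrow>
      \<bar>step_avg D (G n) m x - G (Suc n) m x\<bar> \<le> B (Suc n) m x - step_avg D (B n) m x"
  shows "m \<in> states d \<Longrightarrow> \<bar>walk_avg D g n m x - G n m x\<bar> \<le> B n m x + K"
proof (induction n arbitrary: m x)
  case 0
  then show ?case by (simp add: init)
next
  case (Suc n)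
  have "\<bar>walk_avg D g n (shift m True) (x + D m) - G n (shift m True) (x + D m)\<bar>
      \<le> B n (shift m True) (x + D m) + K"
    "\<bar>walk_avg D g n (shift m False) (x - D m) - G n (shift m False) (x - D m)\<bar>
      \<le> B n (shift m False) (x - D m) + K"
    using Suc shift_in_states[OF d] by blast+
  then have "\<bar>walk_avg D g (Suc n) m x - step_avg D (G n) m x\<bar> \<le> step_avg D (B n) m x + K"
    unfolding step_avg_def walk_avg.simps abs_le_iff by (simp add: field_simps)
  then show ?case
    using step[OF Suc.prems, of n x] by linarith
qed

text \<open>
  Integrate \<open>f3 (x + t) - f3 (x - t)\<close> three times; the symmetry in \<open>t\<close> removes the odd
  derivatives at \<open>x\<close>.
\<close>
lemma second_difference_bound:
  fixes f f1 f2 f3 f4 :: "real \<Rightarrow> real"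
  assumes der: "\<And>x. (f has_real_derivative f1 x) (at x)" "\<And>x. (f1 has_real_derivative f2 x) (at x)"
      "\<And>x. (f2 has_real_derivative f3 x) (at x)" "\<And>x. (f3 has_real_derivative f4 x) (at x)"
    and bound: "\<And>x. \<bar>f4 x\<bar> \<le> K"
  shows "\<bar>f (x + h) + f (x - h) - 2 * f x - h\<^sup>2 * f2 x\<bar> \<le> 2 * K * h ^ 4"
proof -
  have minus: "((\<lambda>t. F (x - t)) has_real_derivative - F' (x - t)) (at t)"
    if "\<And>x. (F has_real_derivative F' x) (at x)" for F F' :: "real \<Rightarrow> real" and t
  proof -
    have "((\<lambda>t. x - t) has_real_derivative - 1) (at t)"
      by (auto intro!: derivative_eq_intros)
    from DERIV_chain2[OF that this] show ?thesis
      by simp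
  qed
  have 3: "\<bar>f3 (x + t) - f3 (x - t)\<bar> \<le> 2 * K * \<bar>t\<bar> ^ 1" for t
    using lipschitz_from_DERIV[OF der(4) bound, of "x + t" "x - t"] by simp
  have 2: "\<bar>f2 (x + t) + f2 (x - t) - 2 * f2 x\<bar> \<le> 2 * K * \<bar>t\<bar> ^ Suc 1" for t
    by (rule integrated_power_bound[OF _ _ 3])
      (auto intro!: derivative_eq_intros DERIV_translate[OF der(3)] minus[OF der(3)])
  have 1: "\<bar>f1 (x + t) - f1 (x - t) - 2 * t * f2 x\<bar> \<le> 2 * K * \<bar>t\<bar> ^ Suc (Suc 1)" for t
    by (rule integrated_power_bound[OF _ _ 2])
      (auto intro!: derivative_eq_intros DERIV_translate[OF der(2)] minus[OF der(2)])
  have "\<bar>f (x + h) + f (x - h) - 2 * f x - h\<^sup>2 * f2 x\<bar> \<le> 2 * K * \<bar>h\<bar> ^ Suc (Suc (Suc 1))"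
    by (rule integrated_power_bound[OF _ _ 1])
      (auto intro!: derivative_eq_intros DERIV_translate[OF der(1)] minus[OF der(1)])
  also have "\<bar>h\<bar> ^ Suc (Suc (Suc 1)) = h ^ 4"
    using power_even_abs[of 4 h] by (simp add: numeral_eq_Suc)
  finally show ?thesis .
qed

lemma linear_approximation_bound_Icc:
  fixes F F' F'' :: "real \<Rightarrow> real"
  assumes "h \<ge> 0"
    and der: "\<And>t. s \<le> t \<Longrightarrow> (F has_real_derivative F' t) (at t)"
      "\<And>t. s \<le> t \<Longrightarrow> (F' has_real_derivative F'' t) (at t)"
    and bound: "\<And>t. s \<le> t \<Longrightarrow> \<bar>F'' t\<bar> \<le> K"
  shows "\<bar>F (s + h) - F s - h * F' s\<bar> \<le> K * h\<^sup>2"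
proof -
  have "0 \<le> K"
    using bound[of s] by simp
  have slope: "norm (F' t - F' s) \<le> K * h" if t: "t \<in> {s..s + h}" for t
  proof -
    have "norm (F' t - F' s) \<le> K * norm (t - s)"
      by (rule field_differentiable_bound[of "{s..}" F' F''])
        (use der bound t in \<open>auto intro: has_field_derivative_at_within\<close>)
    also have "\<dots> \<le> K * h"
      using t \<open>0 \<le> K\<close> by (intro mult_left_mono) auto
    finally show ?thesis .
  qed
  have "norm ((F (s + h) - (s + h) * F' s) - (F s - s * F' s)) \<le> K * h * norm (s + h - s)"
  proof (rule field_differentiable_bound[of "{s..s + h}" _ "\<lambda>t. F' t - F' s"])
    fix t assume "t \<in> {s..s + h}"
    then show "((\<lambda>t. F t - t * F' s) has_real_derivative F' t - F' s) (at t within {s..s + h})"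
      by (auto intro!: derivative_eq_intros has_field_derivative_at_within[OF der(1)])
  qed (use slope assms(1) in auto)
  then show ?thesis
    using assms(1) by (simp add: algebra_simps power2_eq_square)
qed

text \<open>
  For a smooth \<open>u\<close> with fourth-order derivatives (a time derivative counting twice) of size
  \<open>s\<^sup>-\<^sup>3\<^sup>/\<^sup>2\<close>, the corrector \<open>\<gamma> m * u2\<close> turns the state-dependent diffusion rate \<open>(D m)\<^sup>2\<close> into its
  average \<open>C\<close>. The remaining defect is \<open>C\<close> times the defect of \<open>u\<close> in the heat equation, and
  a third-order term caused by the correlation between the sign of a step and the corrector
  at the next state.
\<close>
lemma corrected_step_bound:
  fixes u u1 u2 u3 u4 us uss u2s :: "real \<Rightarrow> real \<Rightarrow> real"
  assumes C: "C > 0" and d: "d \<ge> 1"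
    and D: "\<And>m. m \<in> states d \<Longrightarrow> \<bar>D m\<bar> \<le> 2"
    and \<gamma>: "\<And>m. m \<in> states d \<Longrightarrow> \<gamma> m - state_avg \<gamma> m = ((D m)\<^sup>2 - C) / 2"
    and \<Gamma>: "\<And>m. m \<in> states d \<Longrightarrow> \<bar>\<gamma> m\<bar> \<le> \<Gamma>"
    and der_x: "\<And>s x. s > 0 \<Longrightarrow> (u s has_real_derivative u1 s x) (at x)"
      "\<And>s x. s > 0 \<Longrightarrow> (u1 s has_real_derivative u2 s x) (at x)"
      "\<And>s x. s > 0 \<Longrightarrow> (u2 s has_real_derivative u3 s x) (at x)"
      "\<And>s x. s > 0 \<Longrightarrow> (u3 s has_real_derivative u4 s x) (at x)"
    and der_s: "\<And>s x. s > 0 \<Longrightarrow> ((\<lambda>s. u s x) has_real_derivative us s x) (at s)"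
      "\<And>s x. s > 0 \<Longrightarrow> ((\<lambda>s. us s x) has_real_derivative uss s x) (at s)"
      "\<And>s x. s > 0 \<Longrightarrow> ((\<lambda>s. u2 s x) has_real_derivative u2s s x) (at s)"
    and bounds: "\<And>s x. s \<ge> C \<Longrightarrow> \<bar>u4 s x\<bar> \<le> K / sqrt s ^ 3"
      "\<And>s x. s \<ge> C \<Longrightarrow> \<bar>uss s x\<bar> \<le> K / sqrt s ^ 3"
      "\<And>s x. s \<ge> C \<Longrightarrow> \<bar>u2s s x\<bar> \<le> K / sqrt s ^ 3"
    and s: "s \<ge> C" and m: "m \<in> states d"
  shows "\<bar>step_avg D (\<lambda>m x. u s x + \<gamma> m * u2 s x) m x - (u (s + C) x + \<gamma> m * u2 (s + C) x)
      - C * (u2 s x / 2 - us s x)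
      - D m * (\<gamma> (shift m True) - \<gamma> (shift m False)) / 2 * u3 s x\<bar>
    \<le> (16 + 4 * \<Gamma> + C\<^sup>2 + \<Gamma> * C) * K / sqrt s ^ 3"
proof -
  define \<kappa> where "\<kappa> = K / sqrt s ^ 3"
  have s0: "s > 0"
    using C s by simp
  have K: "0 \<le> K / sqrt s ^ 3"
    using bounds(1)[OF s, of 0] by linarith
  then have "0 \<le> K"
    using s0 by (simp add: zero_le_divide_iff)
  have \<kappa>_decr: "K / sqrt t ^ 3 \<le> \<kappa>" if "t \<ge> s" for t
    unfolding \<kappa>_def using that s0 \<open>0 \<le> K\<close> by (intro divide_left_mono power_mono mult_pos_pos) auto
  have \<kappa>: "0 \<le> \<kappa>"
    using K by (simp add: \<kappa>_def)
  have \<Gamma>0: "0 \<le> \<Gamma>"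
    using \<Gamma>[OF m] by linarith
  have Dsq: "(D m)\<^sup>2 \<le> 4"
    using D[OF m] abs_le_square_iff[of "D m" 2] by simp
  define E1 where "E1 = u s (x + D m) + u s (x - D m) - 2 * u s x - (D m)\<^sup>2 * u2 s x"
  define E2 where "E2 \<delta> = u2 s (x + \<delta>) - u2 s x - \<delta> * u3 s x" for \<delta>
  define E3 where "E3 = u (s + C) x - u s x - C * us s x"
  define E4 where "E4 = u2 (s + C) x - u2 s x"
  have E1: "\<bar>E1\<bar> \<le> 32 * \<kappa>"
  proof -
    have "\<bar>E1\<bar> \<le> 2 * \<kappa> * D m ^ 4"
      unfolding E1_def
      by (rule second_difference_bound[of _ "u1 s" _ "u3 s" "u4 s"])
        (use der_x s0 bounds(1)[OF s] in \<open>auto simp: \<kappa>_def\<close>)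
    also have "D m ^ 4 = ((D m)\<^sup>2)\<^sup>2"
      by simp
    also have "2 * \<kappa> * ((D m)\<^sup>2)\<^sup>2 \<le> 2 * \<kappa> * 4\<^sup>2"
      using Dsq \<kappa> by (intro mult_left_mono power_mono) auto
    finally show ?thesis by simp
  qed
  have E2: "\<bar>E2 \<delta>\<bar> \<le> 4 * \<kappa>" if "\<delta>\<^sup>2 \<le> 4" for \<delta>
  proof -
    have "\<bar>E2 \<delta>\<bar> \<le> \<kappa> * \<delta>\<^sup>2"
      unfolding E2_def
      by (rule DERIV_lipschitz_linear_bound[OF der_x(3)[OF s0] lipschitz_from_DERIV[OF der_x(4)[OF s0]]])
        (use bounds(1)[OF s] in \<open>simp add: \<kappa>_def\<close>)
    also have "\<dots> \<le> \<kappa> * 4"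
      using that \<kappa> by (intro mult_left_mono) auto
    finally show ?thesis by simp
  qed
  have E3: "\<bar>E3\<bar> \<le> \<kappa> * C\<^sup>2"
    unfolding E3_def
  proof (rule linear_approximation_bound_Icc[where F'' = "\<lambda>t. uss t x"])
    fix t assume "s \<le> t"
    then show "\<bar>uss t x\<bar> \<le> \<kappa>"
      using bounds(2)[of t x] \<kappa>_decr[of t] s by linarith
  qed (use C s0 der_s in auto)
  have E4: "\<bar>E4\<bar> \<le> \<kappa> * C"
  proof -
    have "norm (u2 (s + C) x - u2 s x) \<le> \<kappa> * norm (s + C - s)"
    proof (rule field_differentiable_bound[of "{s..}" "\<lambda>t. u2 t x" "\<lambda>t. u2s t x"])
      fix t assume t: "t \<in> {s..}"
      then show "norm (u2s t x) \<le> \<kappa>"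
        using bounds(3)[of t x] \<kappa>_decr[of t] s by simp
      show "((\<lambda>t. u2 t x) has_real_derivative u2s t x) (at t within {s..})"
        using der_s(3)[of t x] t s0 by (auto intro: has_field_derivative_at_within)
    qed (use C in auto)
    then show ?thesis
      using C by (simp add: E4_def)
  qed
  define a where "a = \<gamma> (shift m True)"
  define b where "b = \<gamma> (shift m False)"
  have ab: "\<bar>a\<bar> \<le> \<Gamma>" "\<bar>b\<bar> \<le> \<Gamma>"
    unfolding a_def b_def using \<Gamma> shift_in_states[OF d m] by blast+
  have g: "\<gamma> m = (a + b) / 2 + ((D m)\<^sup>2 - C) / 2"
    using \<gamma>[OF m] unfolding state_avg_def a_def b_def by linarith
  have expansion: "(p + a * p2 + (n + b * n2)) / 2 - (v + c * v2) - C * (z2 / 2 - zs) - e * (a - b) / 2 * z3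
      = (p + n - 2 * z - e\<^sup>2 * z2) / 2 + a * (p2 - z2 - e * z3) / 2 + b * (n2 - z2 - - e * z3) / 2
        - (v - z - C * zs) - c * (v2 - z2)"
    if "c = (a + b) / 2 + (e\<^sup>2 - C) / 2" for p n p2 n2 v v2 z z2 zs z3 c e :: real
    unfolding that by (simp add: field_simps power2_eq_square)
  have eq: "step_avg D (\<lambda>m x. u s x + \<gamma> m * u2 s x) m x - (u (s + C) x + \<gamma> m * u2 (s + C) x)
      - C * (u2 s x / 2 - us s x) - D m * (a - b) / 2 * u3 s x
    = E1 / 2 + a * E2 (D m) / 2 + b * E2 (- D m) / 2 - E3 - \<gamma> m * E4"
    unfolding step_avg_def E1_def E2_def E3_def E4_def a_def[symmetric] b_def[symmetric] diff_conv_add_uminus[of x]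
    by (rule expansion[OF g])
  have prod: "\<bar>c * e\<bar> \<le> \<Gamma> * \<epsilon>" if "\<bar>c\<bar> \<le> \<Gamma>" "\<bar>e\<bar> \<le> \<epsilon>" for c e \<epsilon> :: real
    unfolding abs_mult using that \<Gamma>0 by (intro mult_mono) auto
  have "\<bar>E1 / 2 + a * E2 (D m) / 2 + b * E2 (- D m) / 2 - E3 - \<gamma> m * E4\<bar>
      \<le> 16 * \<kappa> + \<Gamma> * (4 * \<kappa>) + \<kappa> * C\<^sup>2 + \<Gamma> * (\<kappa> * C)"
    using E1 prod[OF ab(1) E2[OF Dsq]] prod[OF ab(2) E2[OF Dsq[folded power2_minus[of "D m"]]]]
      E3 prod[OF \<Gamma>[OF m] E4]
    by linarith
  also have "\<dots> = (16 + 4 * \<Gamma> + C\<^sup>2 + \<Gamma> * C) * K / sqrt s ^ 3"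
    by (simp add: \<kappa>_def algebra_simps add_divide_distrib)
  finally show ?thesis
    unfolding eq[symmetric] unfolding a_def b_def .
qed

section \<open>Convergence of the averaged walk to the heat profile\<close>

lemma sign_corrector_product_bound:
  assumes d: "d \<ge> 1"
    and D: "\<And>m. m \<in> states d \<Longrightarrow> \<bar>D m\<bar> \<le> 2"
    and \<Gamma>: "\<And>m. m \<in> states d \<Longrightarrow> \<bar>\<gamma> m\<bar> \<le> \<Gamma>"
    and m: "m \<in> states d"
  shows "\<bar>D m * (\<gamma> (shift m True) - \<gamma> (shift m False)) / 2\<bar> \<le> (2 :: real) * \<Gamma>"
proof -
  have "\<bar>\<gamma> (shift m True) - \<gamma> (shift m False)\<bar> \<le> 2 * \<Gamma>"
    using \<Gamma>[OF shift_in_states[OF d m], of True] \<Gamma>[OF shift_in_states[OF d m], of False]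
    by linarith
  then have "\<bar>D m * (\<gamma> (shift m True) - \<gamma> (shift m False))\<bar> \<le> 2 * (2 * \<Gamma>)"
    unfolding abs_mult using D[OF m] by (intro mult_mono) auto
  then show ?thesis
    by simp
qed

text \<open>
  The profile solves the heat equation, so only the third-order term and the summable error
  are left. The third-order term is bounded by a Gaussian, wider than the heat kernel, that the
  barrier below can dominate.
\<close>
lemma heat_step_bound:
  assumes C: "C > 0" and d: "d \<ge> 1"
    and D: "\<And>m. m \<in> states d \<Longrightarrow> \<bar>D m\<bar> \<le> 2"
    and \<gamma>: "\<And>m. m \<in> states d \<Longrightarrow> \<gamma> m - state_avg \<gamma> m = ((D m)\<^sup>2 - C) / 2"
    and \<Gamma>: "\<And>m. m \<in> states d \<Longrightarrow> \<bar>\<gamma> m\<bar> \<le> \<Gamma>"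
  obtains K1 K2 where "K1 \<ge> 0" "K2 \<ge> 0"
    "\<And>s x m. s \<ge> C \<Longrightarrow> m \<in> states d \<Longrightarrow>
      \<bar>step_avg D (\<lambda>m x. gauss_abs (sqrt s) x + \<gamma> m * heat_curvature s x) m x
        - (gauss_abs (sqrt (s + C)) x + \<gamma> m * heat_curvature (s + C) x)\<bar>
      \<le> K1 * gauss_family 1 (1 / 4) 2 s x + K2 / sqrt s ^ 3"
proof -
  define p2 where "p2 = [:1 / sqrt (2 * pi):]"
  define dx where "dx p = pderiv p - [:0, 2 * (1 / 2):] * p" for p :: "real poly"
  define ds where "ds p = smult (- real 1 / 2) p - smult (1 / 2) (pCons 0 (dx p))" for p :: "real poly"
  obtain K4 where K4: "K4 \<ge> 0" "\<And>s x. s > 0 \<Longrightarrow> \<bar>gauss_family (dx (dx p2)) (1 / 2) 3 s x\<bar> \<le> K4 / sqrt s ^ 3"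
    using gauss_family_bound[of "1 / 2"] by auto
  obtain Ks where Ks: "Ks \<ge> 0" "\<And>s x. s > 0 \<Longrightarrow> \<bar>gauss_family (ds p2) (1 / 2) 3 s x\<bar> \<le> Ks / sqrt s ^ 3"
    using gauss_family_bound[of "1 / 2"] by auto
  obtain K3 where K3: "K3 \<ge> 0"
    "\<And>s x. s > 0 \<Longrightarrow> \<bar>gauss_family (dx p2) (1 / 2) 2 s x\<bar> \<le> K3 * gauss_family 1 (1 / 4) 2 s x"
    using gauss_family_bound_gauss[of "1 / 4" "1 / 2"] by auto
  define K where "K = K4 + Ks"
  have curv: "heat_curvature = gauss_family p2 (1 / 2) 1"
    by (simp add: heat_curvature_def p2_def)
  have curv_s: "((\<lambda>s. heat_curvature s x) has_real_derivative gauss_family (ds p2) (1 / 2) 3 s x) (at s)"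
    if "s > 0" for s x
    using gauss_family_DERIV_s[OF that, of p2 "1 / 2" 1 x]
    by (simp add: curv ds_def dx_def numeral_3_eq_3)
  have \<Gamma>0: "0 \<le> \<Gamma>"
  proof -
    obtain m where "m \<in> states d"
      using states_nonempty[of d] by blast
    from \<Gamma>[OF this] show ?thesis
      by linarith
  qed
  have bound: "\<bar>step_avg D (\<lambda>m x. gauss_abs (sqrt s) x + \<gamma> m * heat_curvature s x) m x
      - (gauss_abs (sqrt (s + C)) x + \<gamma> m * heat_curvature (s + C) x)
      - C * (heat_curvature s x / 2 - heat_curvature s x / 2)
      - D m * (\<gamma> (shift m True) - \<gamma> (shift m False)) / 2 * gauss_family (dx p2) (1 / 2) 2 s x\<bar>
    \<le> (16 + 4 * \<Gamma> + C\<^sup>2 + \<Gamma> * C) * K / sqrt s ^ 3"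
    if s: "s \<ge> C" and m: "m \<in> states d" for s x m
  proof (rule corrected_step_bound[OF C d D \<gamma> \<Gamma> gauss_abs_DERIV_x normal_primitive_DERIV_x _ _
        gauss_abs_DERIV_s _ curv_s _ _ _ s m])
    fix s x :: real assume "s > 0"
    then show "(heat_curvature s has_real_derivative gauss_family (dx p2) (1 / 2) 2 s x) (at x)"
      using gauss_family_DERIV_x[of s p2 "1 / 2" 1 x] by (simp add: curv dx_def numeral_2_eq_2)
    show "(gauss_family (dx p2) (1 / 2) 2 s has_real_derivative gauss_family (dx (dx p2)) (1 / 2) 3 s x) (at x)"
      using gauss_family_DERIV_x[OF \<open>s > 0\<close>, of "dx p2" "1 / 2" 2 x]
      unfolding dx_def[of "dx p2"] by (simp add: numeral_3_eq_3 numeral_2_eq_2)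
    show "((\<lambda>s. heat_curvature s x / 2) has_real_derivative gauss_family (ds p2) (1 / 2) 3 s x / 2) (at s)"
      by (intro DERIV_cdivide curv_s \<open>s > 0\<close>)
  next
    fix s x assume "s \<ge> C"
    then have s0: "s > 0"
      using C by simp
    have le: "K4 / sqrt s ^ 3 \<le> K / sqrt s ^ 3" "Ks / sqrt s ^ 3 \<le> K / sqrt s ^ 3"
      using K4(1) Ks(1) s0 by (auto simp: K_def intro!: divide_right_mono)
    show "\<bar>gauss_family (dx (dx p2)) (1 / 2) 3 s x\<bar> \<le> K / sqrt s ^ 3"
      using K4(2)[OF s0, of x] le by linarith
    show "\<bar>gauss_family (ds p2) (1 / 2) 3 s x\<bar> \<le> K / sqrt s ^ 3"
      using Ks(2)[OF s0, of x] le by linarith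
    moreover have "\<bar>gauss_family (ds p2) (1 / 2) 3 s x / 2\<bar> \<le> \<bar>gauss_family (ds p2) (1 / 2) 3 s x\<bar>"
      by simp
    ultimately show "\<bar>gauss_family (ds p2) (1 / 2) 3 s x / 2\<bar> \<le> K / sqrt s ^ 3"
      by (rule order_trans[rotated])
  qed
  show thesis
  proof
    show "0 \<le> 2 * \<Gamma> * K3" "0 \<le> (16 + 4 * \<Gamma> + C\<^sup>2 + \<Gamma> * C) * K"
      using \<Gamma>0 K3(1) K4(1) Ks(1) C by (simp_all add: K_def)
    fix s x m assume s: "s \<ge> C" and m: "m \<in> states d"
    have "\<bar>D m * (\<gamma> (shift m True) - \<gamma> (shift m False)) / 2 * gauss_family (dx p2) (1 / 2) 2 s x\<bar>
        \<le> 2 * \<Gamma> * (K3 * gauss_family 1 (1 / 4) 2 s x)"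
    proof -
      have "\<bar>D m * (\<gamma> (shift m True) - \<gamma> (shift m False)) / 2\<bar> \<le> 2 * \<Gamma>"
        by (rule sign_corrector_product_bound[OF d D \<Gamma> m])
      then show ?thesis
        unfolding abs_mult[of "D m * (\<gamma> (shift m True) - \<gamma> (shift m False)) / 2"]
        using K3(2)[of s x] C s \<Gamma>0 by (intro mult_mono) auto
    qed
    then show "\<bar>step_avg D (\<lambda>m x. gauss_abs (sqrt s) x + \<gamma> m * heat_curvature s x) m x
        - (gauss_abs (sqrt (s + C)) x + \<gamma> m * heat_curvature (s + C) x)\<bar>
      \<le> 2 * \<Gamma> * K3 * gauss_family 1 (1 / 4) 2 s x + (16 + 4 * \<Gamma> + C\<^sup>2 + \<Gamma> * C) * K / sqrt s ^ 3"
      using bound[OF s m, of x] by simp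
  qed
qed

text \<open>
  The second derivative in \<open>x\<close> of the barrier \<open>exp (- x\<^sup>2 / (4 s))\<close>, which is
  \<open>gauss_family 1 (1 / 4) 0 s x\<close>.
\<close>
definition barrier_curvature :: "real \<Rightarrow> real \<Rightarrow> real" where
  "barrier_curvature = gauss_family [:- 1 / 2, 0, 1 / 4:] (1 / 4) 2"

text \<open>
  With \<open>P = exp (- x\<^sup>2 / (4 s))\<close>, one has
  \<open>P\<^sub>s - P\<^sub>x\<^sub>x / 2 = (1 / 4 + x\<^sup>2 / (8 s)) P / s \<ge> P / (4 s)\<close>.
  The third \<open>x\<close>-derivative of \<open>P\<close> is already of order \<open>s\<^sup>-\<^sup>3\<^sup>/\<^sup>2\<close>, as \<open>P\<close> is bounded whereas the heat
  profile grows like \<open>sqrt s\<close>.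
\<close>
lemma barrier_step_bound:
  assumes C: "C > 0" and d: "d \<ge> 1"
    and D: "\<And>m. m \<in> states d \<Longrightarrow> \<bar>D m\<bar> \<le> 2"
    and \<gamma>: "\<And>m. m \<in> states d \<Longrightarrow> \<gamma> m - state_avg \<gamma> m = ((D m)\<^sup>2 - C) / 2"
    and \<Gamma>: "\<And>m. m \<in> states d \<Longrightarrow> \<bar>\<gamma> m\<bar> \<le> \<Gamma>"
  obtains K where "K \<ge> 0"
    "\<And>s x m. s \<ge> C \<Longrightarrow> m \<in> states d \<Longrightarrow>
      step_avg D (\<lambda>m x. gauss_family 1 (1 / 4) 0 s x + \<gamma> m * barrier_curvature s x) m x
      \<le> gauss_family 1 (1 / 4) 0 (s + C) x + \<gamma> m * barrier_curvature (s + C) x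
        - C / 4 * gauss_family 1 (1 / 4) 2 s x + K / sqrt s ^ 3"
proof -
  define P2 :: "real poly" where "P2 = [:- 1 / 2, 0, 1 / 4:]"
  have curv: "barrier_curvature = gauss_family P2 (1 / 4) 2"
    by (simp add: barrier_curvature_def P2_def)
  define dx where "dx p = pderiv p - [:0, 2 * (1 / 4):] * p" for p :: "real poly"
  define ds where "ds j p = smult (- real j / 2) p - smult (1 / 2) (pCons 0 (dx p))" for j and p :: "real poly"
  have x_der: "(gauss_family p (1 / 4) j s has_real_derivative gauss_family (dx p) (1 / 4) (Suc j) s x) (at x)"
    if "s > 0" for p j s x
    using gauss_family_DERIV_x[OF that, of p "1 / 4" j x] by (simp add: dx_def)
  have s_der: "((\<lambda>s. gauss_family p (1 / 4) j s x) has_real_derivative gauss_family (ds j p) (1 / 4) (j + 2) s x) (at s)"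
    if "s > 0" for p j s x
    using gauss_family_DERIV_s[OF that, of p "1 / 4" j x] by (simp add: ds_def dx_def)
  have P2: "dx (dx 1) = P2"
    by (simp add: dx_def P2_def one_pCons pderiv_pCons)
  obtain A3 where A3: "A3 \<ge> 0" "\<And>s x. s > 0 \<Longrightarrow> \<bar>gauss_family (dx P2) (1 / 4) 3 s x\<bar> \<le> A3 / sqrt s ^ 3"
    using gauss_family_bound[of "1 / 4"] by auto
  obtain A4 where A4: "A4 \<ge> 0" "\<And>s x. s > 0 \<Longrightarrow> \<bar>gauss_family (dx (dx P2)) (1 / 4) 4 s x\<bar> \<le> A4 / sqrt s ^ 4"
    using gauss_family_bound[of "1 / 4"] by auto
  obtain B4 where B4: "B4 \<ge> 0" "\<And>s x. s > 0 \<Longrightarrow> \<bar>gauss_family (ds 2 (ds 0 1)) (1 / 4) 4 s x\<bar> \<le> B4 / sqrt s ^ 4"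
    using gauss_family_bound[of "1 / 4"] by auto
  obtain E4 where E4: "E4 \<ge> 0" "\<And>s x. s > 0 \<Longrightarrow> \<bar>gauss_family (ds 2 P2) (1 / 4) 4 s x\<bar> \<le> E4 / sqrt s ^ 4"
    using gauss_family_bound[of "1 / 4"] by auto
  define K where "K = (A4 + B4 + E4) / sqrt C"
  have \<Gamma>0: "0 \<le> \<Gamma>"
  proof -
    obtain m where "m \<in> states d"
      using states_nonempty[of d] by blast
    from \<Gamma>[OF this] show ?thesis
      by linarith
  qed
  have K0: "0 \<le> K"
    using A4(1) B4(1) E4(1) C by (simp add: K_def)
  have fourth: "A / sqrt s ^ 4 \<le> K / sqrt s ^ 3" if "s \<ge> C" "0 \<le> A" "A \<le> A4 + B4 + E4" for s A
  proof -
    have "A / sqrt s ^ 4 = A / sqrt s / sqrt s ^ 3"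
      by (simp add: eval_nat_numeral)
    also have "A / sqrt s \<le> K"
      unfolding K_def using that C by (intro frac_le) auto
    finally show ?thesis
      using that C by (simp add: divide_right_mono)
  qed
  have bound: "\<bar>step_avg D (\<lambda>m x. gauss_family 1 (1 / 4) 0 s x + \<gamma> m * gauss_family P2 (1 / 4) 2 s x) m x
      - (gauss_family 1 (1 / 4) 0 (s + C) x + \<gamma> m * gauss_family P2 (1 / 4) 2 (s + C) x)
      - C * (gauss_family P2 (1 / 4) 2 s x / 2 - gauss_family (ds 0 1) (1 / 4) 2 s x)
      - D m * (\<gamma> (shift m True) - \<gamma> (shift m False)) / 2 * gauss_family (dx P2) (1 / 4) 3 s x\<bar>
    \<le> (16 + 4 * \<Gamma> + C\<^sup>2 + \<Gamma> * C) * K / sqrt s ^ 3"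
    if s: "s \<ge> C" and m: "m \<in> states d" for s x m
  proof (rule corrected_step_bound[OF C d D \<gamma> \<Gamma> _ _ _ _ _ _ _ _ _ _ s m])
    fix s x :: real assume s: "s > 0"
    show "(gauss_family 1 (1 / 4) 0 s has_real_derivative gauss_family (dx 1) (1 / 4) 1 s x) (at x)"
      using x_der[OF s, of 1 0] by simp
    show "(gauss_family (dx 1) (1 / 4) 1 s has_real_derivative gauss_family P2 (1 / 4) 2 s x) (at x)"
      using x_der[OF s, of "dx 1" 1] by (simp add: P2 numeral_2_eq_2)
    show "(gauss_family P2 (1 / 4) 2 s has_real_derivative gauss_family (dx P2) (1 / 4) 3 s x) (at x)"
      using x_der[OF s, of P2 2] by (simp add: numeral_2_eq_2 numeral_3_eq_3)
    show "(gauss_family (dx P2) (1 / 4) 3 s has_real_derivative gauss_family (dx (dx P2)) (1 / 4) 4 s x) (at x)"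
      using x_der[OF s, of "dx P2" 3] by (simp add: eval_nat_numeral)
    show "((\<lambda>s. gauss_family 1 (1 / 4) 0 s x) has_real_derivative gauss_family (ds 0 1) (1 / 4) 2 s x) (at s)"
      using s_der[OF s, of 1 0 x] by (simp add: numeral_2_eq_2)
    show "((\<lambda>s. gauss_family (ds 0 1) (1 / 4) 2 s x) has_real_derivative
        gauss_family (ds 2 (ds 0 1)) (1 / 4) 4 s x) (at s)"
      using s_der[OF s, of "ds 0 1" 2 x] by simp
    show "((\<lambda>s. gauss_family P2 (1 / 4) 2 s x) has_real_derivative gauss_family (ds 2 P2) (1 / 4) 4 s x) (at s)"
      using s_der[OF s, of P2 2 x] by simp
  next
    fix s x assume s: "s \<ge> C"
    then have s0: "s > 0"
      using C by simp
    show "\<bar>gauss_family (dx (dx P2)) (1 / 4) 4 s x\<bar> \<le> K / sqrt s ^ 3"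
      using A4(2)[OF s0, of x] fourth[OF s, of A4] A4(1) B4(1) E4(1) by linarith
    show "\<bar>gauss_family (ds 2 (ds 0 1)) (1 / 4) 4 s x\<bar> \<le> K / sqrt s ^ 3"
      using B4(2)[OF s0, of x] fourth[OF s, of B4] A4(1) B4(1) E4(1) by linarith
    show "\<bar>gauss_family (ds 2 P2) (1 / 4) 4 s x\<bar> \<le> K / sqrt s ^ 3"
      using E4(2)[OF s0, of x] fourth[OF s, of E4] A4(1) B4(1) E4(1) by linarith
  qed
  show thesis
  proof (rule that, unfold curv)
    show "0 \<le> 2 * \<Gamma> * A3 + (16 + 4 * \<Gamma> + C\<^sup>2 + \<Gamma> * C) * K"
      using \<Gamma>0 A3(1) K0 C by simp
    fix s x m assume s: "s \<ge> C" and m: "m \<in> states d"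
    then have s0: "s > 0"
      using C by simp
    have third: "\<bar>D m * (\<gamma> (shift m True) - \<gamma> (shift m False)) / 2 * gauss_family (dx P2) (1 / 4) 3 s x\<bar>
        \<le> 2 * \<Gamma> * (A3 / sqrt s ^ 3)"
    proof -
      have "\<bar>D m * (\<gamma> (shift m True) - \<gamma> (shift m False)) / 2\<bar> \<le> 2 * \<Gamma>"
        by (rule sign_corrector_product_bound[OF d D \<Gamma> m])
      then show ?thesis
        unfolding abs_mult[of "D m * (\<gamma> (shift m True) - \<gamma> (shift m False)) / 2"]
        using A3(2)[OF s0, of x] \<Gamma>0 by (intro mult_mono) auto
    qed
    have "gauss_family P2 (1 / 4) 2 s x / 2 - gauss_family (ds 0 1) (1 / 4) 2 s x \<le> - (gauss_family 1 (1 / 4) 2 s x / 4)"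
    proof -
      define y where "y = x / sqrt s"
      define E where "E = exp (- (1 / 4) * y\<^sup>2) / sqrt s ^ 2"
      have gf: "gauss_family p (1 / 4) 2 s x = poly p y * E" for p
        by (simp add: gauss_family_def y_def E_def)
      have "poly P2 y / 2 - poly (ds 0 1) y = - 1 / 4 - y\<^sup>2 / 8"
        by (simp add: P2_def ds_def dx_def power2_eq_square field_simps)
      also have "\<dots> \<le> - 1 / 4"
        by simp
      finally have "(poly P2 y / 2 - poly (ds 0 1) y) * E \<le> - 1 / 4 * E"
        unfolding E_def using s0 by (intro mult_right_mono) auto
      then show ?thesis
        by (simp add: gf left_diff_distrib)
    qed
    then have "C * (gauss_family P2 (1 / 4) 2 s x / 2 - gauss_family (ds 0 1) (1 / 4) 2 s x)
        \<le> C * - (gauss_family 1 (1 / 4) 2 s x / 4)"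
      using C by (intro mult_left_mono) auto
    then show "step_avg D (\<lambda>m x. gauss_family 1 (1 / 4) 0 s x + \<gamma> m * gauss_family P2 (1 / 4) 2 s x) m x
      \<le> gauss_family 1 (1 / 4) 0 (s + C) x + \<gamma> m * gauss_family P2 (1 / 4) 2 (s + C) x
        - C / 4 * gauss_family 1 (1 / 4) 2 s x
        + (2 * \<Gamma> * A3 + (16 + 4 * \<Gamma> + C\<^sup>2 + \<Gamma> * C) * K) / sqrt s ^ 3"
      using bound[OF s m, of x] third by (simp add: add_divide_distrib abs_le_iff)
  qed
qed

text \<open>
  Makes \<open>- 1 / sqrt s\<close> a bounded supersolution whose surplus dominates errors of order
  \<open>s\<^sup>-\<^sup>3\<^sup>/\<^sup>2\<close>.
\<close>
lemma inverse_sqrt_decrement: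
  assumes "C > 0" "s \<ge> C"
  shows "C / 6 / sqrt s ^ 3 \<le> 1 / sqrt s - 1 / sqrt (s + C)"
proof -
  define a where "a = sqrt s"
  define b where "b = sqrt (s + C)"
  have a: "a > 0" "a\<^sup>2 = s" and b: "b > 0" "b\<^sup>2 = s + C"
    using assms by (auto simp: a_def b_def)
  have "b \<le> 2 * a"
  proof (rule power2_le_imp_le)
    show "b\<^sup>2 \<le> (2 * a)\<^sup>2"
      using assms by (simp add: power_mult_distrib a b)
  qed (use a in simp)
  then have "a * b * (a + b) \<le> a * (2 * a) * (3 * a)"
    using a b by (intro mult_mono) auto
  then have "C / (a * (2 * a) * (3 * a)) \<le> C / (a * b * (a + b))"
    using a b assms by (intro divide_left_mono) auto
  moreover have "C / (a * b * (a + b)) = 1 / a - 1 / b"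
  proof -
    have "C = (b - a) * (a + b)"
      using a b by (simp add: algebra_simps power2_eq_square)
    then have "C / (a * b * (a + b)) = (b - a) / (a * b)"
      using a b by simp
    then show ?thesis
      using a b by (simp add: diff_divide_distrib)
  qed
  moreover have "C / (a * (2 * a) * (3 * a)) = C / 6 / a ^ 3"
    by (simp add: power3_eq_cube mult_ac)
  ultimately have "C / 6 / a ^ 3 \<le> 1 / a - 1 / b"
    by (simp only:)
  then show ?thesis
    by (simp only: a_def b_def)
qed

text \<open>
  A central limit theorem in the mean of \<open>\<bar>x + S\<^sub>n\<bar>\<close> with a bounded error. The comparison uses
  the corrected heat profile \<open>G\<close> and the barrier \<open>B\<close>, whose coefficients \<open>a\<close> and \<open>b\<close> are such
  that the surplus of \<open>B\<close> covers the two kinds of error of \<open>G\<close>. Time is started at \<open>C\<close> rather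
  than at 0, where the derivatives of the profile blow up; this changes the profile by at most
  \<open>sqrt C\<close>.
\<close>
lemma walk_avg_near_heat:
  assumes d: "d \<ge> 1"
    and D: "\<And>m. m \<in> states d \<Longrightarrow> \<bar>D m\<bar> \<le> 2"
    and C: "state_mean d (\<lambda>m. (D m)\<^sup>2) > 0"
  obtains K where "\<And>n m x. m \<in> states d \<Longrightarrow>
    \<bar>walk_avg D (\<lambda>x. \<bar>x\<bar> / 2) n m x - gauss_abs (sqrt (state_mean d (\<lambda>m. (D m)\<^sup>2) * n)) x\<bar> \<le> K"
proof -
  define C where "C = state_mean d (\<lambda>m. (D m)\<^sup>2)"
  have C0: "C > 0"
    using C by (simp add: C_def)
  obtain \<gamma>' where \<gamma>': "\<And>m. m \<in> states d \<Longrightarrow> \<gamma>' m - state_avg \<gamma>' m = (D m)\<^sup>2 - C"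
    using poisson_solution[OF d, of "\<lambda>m. (D m)\<^sup>2"] unfolding C_def by blast
  \<comment> \<open>The corrector has to balance half the squared increment.\<close>
  define \<gamma> where "\<gamma> m = \<gamma>' m / 2" for m
  have \<gamma>: "\<gamma> m - state_avg \<gamma> m = ((D m)\<^sup>2 - C) / 2" if "m \<in> states d" for m
    using \<gamma>'[OF that] by (simp add: \<gamma>_def state_avg_def field_simps)
  define \<Gamma> where "\<Gamma> = Max ((\<lambda>m. \<bar>\<gamma> m\<bar>) ` states d)"
  have \<Gamma>: "\<bar>\<gamma> m\<bar> \<le> \<Gamma>" if "m \<in> states d" for m
    unfolding \<Gamma>_def using that finite_states by (intro Max_ge) auto
  have \<Gamma>0: "0 \<le> \<Gamma>"
  proof -
    obtain m where "m \<in> states d"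
      using states_nonempty[of d] by blast
    from \<Gamma>[OF this] show ?thesis
      by linarith
  qed
  obtain K1 K2 where K1: "K1 \<ge> 0" and K2: "K2 \<ge> 0"
    and heat: "\<And>s x m. s \<ge> C \<Longrightarrow> m \<in> states d \<Longrightarrow>
      \<bar>step_avg D (\<lambda>m x. gauss_abs (sqrt s) x + \<gamma> m * heat_curvature s x) m x
        - (gauss_abs (sqrt (s + C)) x + \<gamma> m * heat_curvature (s + C) x)\<bar>
      \<le> K1 * gauss_family 1 (1 / 4) 2 s x + K2 / sqrt s ^ 3"
    by (rule heat_step_bound[OF C0 d D \<gamma> \<Gamma>], assumption+, rule that)
  obtain K3 where K3: "K3 \<ge> 0"
    and barrier: "\<And>s x m. s \<ge> C \<Longrightarrow> m \<in> states d \<Longrightarrow>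
      step_avg D (\<lambda>m x. gauss_family 1 (1 / 4) 0 s x + \<gamma> m * barrier_curvature s x) m x
      \<le> gauss_family 1 (1 / 4) 0 (s + C) x + \<gamma> m * barrier_curvature (s + C) x
        - C / 4 * gauss_family 1 (1 / 4) 2 s x + K3 / sqrt s ^ 3"
    by (rule barrier_step_bound[OF C0 d D \<gamma> \<Gamma>], assumption+, rule that)
  obtain H where H: "H \<ge> 0" "\<And>s x. s > 0 \<Longrightarrow> \<bar>gauss_family [:1 / sqrt (2 * pi):] (1 / 2) 1 s x\<bar> \<le> H / sqrt s ^ 1"
    by (rule gauss_family_bound[of "1 / 2" "[:1 / sqrt (2 * pi):]" 1], simp, rule that)
  note H = H(1) H(2)[folded heat_curvature_def]
  obtain Q where Q: "Q \<ge> 0" "\<And>s x. s > 0 \<Longrightarrow> \<bar>gauss_family [:- 1 / 2, 0, 1 / 4:] (1 / 4) 2 s x\<bar> \<le> Q / sqrt s ^ 2"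
    by (rule gauss_family_bound[of "1 / 4" "[:- 1 / 2, 0, 1 / 4:]" 2], simp, rule that)
  note Q = Q(1) Q(2)[folded barrier_curvature_def]
  define a where "a = 4 * K1 / C"
  define b where "b = 6 * (K2 + a * K3) / C"
  have a: "a \<ge> 0" "a * (C / 4) = K1"
    using K1 C0 by (simp_all add: a_def)
  have b: "b \<ge> 0" "b * (C / 6) = K2 + a * K3"
    using K2 K3 a C0 by (simp_all add: b_def)
  \<comment> \<open>One extra unit of time keeps the profile away from its singularity at time 0.\<close>
  define S where "S n = C * (real n + 1)" for n
  have S: "S n \<ge> C" "S n > 0" "S (Suc n) = S n + C" for n
    using C0 by (simp_all add: S_def algebra_simps add_pos_nonneg)
  have S_sqrt: "sqrt (S n) \<ge> sqrt C" for n
    using S by simp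
  define G where "G n m x = gauss_abs (sqrt (S n)) x + \<gamma> m * heat_curvature (S n) x" for n m x
  define R where "R n m x = gauss_family 1 (1 / 4) 0 (S n) x + \<gamma> m * barrier_curvature (S n) x" for n m x
  define B where "B n m x = a * R n m x - b / sqrt (S n)" for n m x
  have step: "\<bar>step_avg D (G n) m x - G (Suc n) m x\<bar> \<le> B (Suc n) m x - step_avg D (B n) m x"
    if m: "m \<in> states d" for n m x
  proof -
    define s where "s = S n"
    define \<theta> where "\<theta> = gauss_family 1 (1 / 4) 2 s x"
    define \<kappa> where "\<kappa> = 1 / sqrt s ^ 3"
    have "\<bar>step_avg D (G n) m x - G (Suc n) m x\<bar> \<le> K1 * \<theta> + K2 * \<kappa>"
      using heat[OF S(1) m, of n x] by (simp add: G_def[abs_def] S(3) \<theta>_def \<kappa>_def s_def)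
    moreover have "step_avg D (B n) m x = a * step_avg D (R n) m x - b / sqrt s"
      by (simp add: step_avg_def B_def s_def field_simps)
    moreover have "a * step_avg D (R n) m x \<le> a * (R (Suc n) m x - C / 4 * \<theta> + K3 * \<kappa>)"
      using barrier[OF S(1) m, of n x] a(1)
      by (intro mult_left_mono) (simp_all add: R_def[abs_def] S(3) \<theta>_def \<kappa>_def s_def)
    moreover have "b * (C / 6 * \<kappa>) \<le> b * (1 / sqrt s - 1 / sqrt (S (Suc n)))"
      using inverse_sqrt_decrement[OF C0 S(1), of n] b(1)
      by (intro mult_left_mono) (simp_all add: \<kappa>_def s_def S(3))
    moreover have "a * (R (Suc n) m x - C / 4 * \<theta> + K3 * \<kappa>) = a * R (Suc n) m x - K1 * \<theta> + a * K3 * \<kappa>"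
      unfolding a(2)[symmetric] by (simp add: algebra_simps)
    moreover have "b * (C / 6 * \<kappa>) = K2 * \<kappa> + a * K3 * \<kappa>"
      unfolding mult.assoc[symmetric] b(2)[unfolded mult.assoc[symmetric]] by (simp add: algebra_simps)
    moreover have "b * (1 / sqrt s - 1 / sqrt (S (Suc n))) = b / sqrt s - b / sqrt (S (Suc n))"
      by (simp add: right_diff_distrib)
    ultimately show ?thesis
      unfolding B_def[of "Suc n"] by linarith
  qed
  define KR where "KR = 1 + \<Gamma> * (Q / C)"
  have R_bound: "\<bar>R n m x\<bar> \<le> KR" if m: "m \<in> states d" for n m x
  proof -
    have "\<bar>gauss_family 1 (1 / 4) 0 (S n) x\<bar> \<le> 1"
      by (simp add: gauss_family_def)
    moreover have "\<bar>\<gamma> m * barrier_curvature (S n) x\<bar> \<le> \<Gamma> * (Q / C)"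
      unfolding abs_mult
    proof (intro mult_mono \<Gamma> m)
      have "\<bar>barrier_curvature (S n) x\<bar> \<le> Q / S n"
        using Q(2)[OF S(2), of n x] S(2)[of n] by simp
      also have "\<dots> \<le> Q / C"
        using S(1)[of n] C0 Q(1) by (intro divide_left_mono) auto
      finally show "\<bar>barrier_curvature (S n) x\<bar> \<le> Q / C" .
    qed (use \<Gamma>0 in auto)
    ultimately show ?thesis
      unfolding R_def KR_def by linarith
  qed
  define KB where "KB = a * KR + b / sqrt C"
  have B_bound: "\<bar>B n m x\<bar> \<le> KB" if m: "m \<in> states d" for n m x
  proof -
    have "\<bar>a * R n m x\<bar> \<le> a * KR"
      unfolding abs_mult using R_bound[OF m] a(1) by (simp add: mult_left_mono)
    moreover have "\<bar>b / sqrt (S n)\<bar> \<le> b / sqrt C"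
      using b(1) S_sqrt[of n] C0 S(2)[of n] by (simp add: divide_left_mono)
    ultimately show ?thesis
      unfolding B_def KB_def by linarith
  qed
  define KG where "KG = \<Gamma> * (H / sqrt C)"
  have G_bound: "\<bar>G n m x - gauss_abs (sqrt (S n)) x\<bar> \<le> KG" if m: "m \<in> states d" for n m x
  proof -
    have "\<bar>heat_curvature (S n) x\<bar> \<le> H / sqrt (S n)"
      using H(2)[OF S(2), of n x] by simp
    also have "\<dots> \<le> H / sqrt C"
      using S_sqrt[of n] C0 H(1) S(2)[of n] by (intro divide_left_mono) auto
    finally have "\<bar>\<gamma> m\<bar> * \<bar>heat_curvature (S n) x\<bar> \<le> \<Gamma> * (H / sqrt C)"
      using \<Gamma>[OF m] \<Gamma>0 by (intro mult_mono) auto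
    then show ?thesis
      by (simp add: G_def KG_def abs_mult)
  qed
  have init: "\<bar>\<bar>x\<bar> / 2 - G 0 m x\<bar> \<le> B 0 m x + (sqrt C + KG + KB)" if m: "m \<in> states d" for m x
  proof -
    have "\<bar>gauss_abs 0 x - gauss_abs (sqrt C) x\<bar> \<le> sqrt C"
      using gauss_abs_lipschitz[of 0 x "sqrt C"] C0 by simp
    moreover have "S 0 = C"
      by (simp add: S_def)
    ultimately show ?thesis
      using G_bound[OF m, of 0 x] B_bound[OF m, of 0 x] unfolding gauss_abs_zero by simp
  qed
  show thesis
  proof
    fix n m x assume m: "m \<in> states d"
    have "\<bar>walk_avg D (\<lambda>x. \<bar>x\<bar> / 2) n m x - G n m x\<bar> \<le> B n m x + (sqrt C + KG + KB)"
      by (rule walk_avg_comparison[where G = G and B = B, OF d init step m])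
    moreover have "\<bar>gauss_abs (sqrt (S n)) x - gauss_abs (sqrt (C * n)) x\<bar> \<le> sqrt C"
    proof -
      have "S n = C * n + C"
        by (simp add: S_def algebra_simps)
      then have "\<bar>sqrt (S n) - sqrt (C * n)\<bar> \<le> sqrt C"
        using sqrt_add_le_add_sqrt[of "C * n" C] C0 by simp
      then show ?thesis
        using gauss_abs_lipschitz[of "sqrt (S n)" x "sqrt (C * n)"] by linarith
    qed
    ultimately have "\<bar>walk_avg D (\<lambda>x. \<bar>x\<bar> / 2) n m x - gauss_abs (sqrt (C * n)) x\<bar>
        \<le> 2 * sqrt C + 2 * KG + 2 * KB"
      using G_bound[OF m, of n x] B_bound[OF m, of n x] by linarith
    then show "\<bar>walk_avg D (\<lambda>x. \<bar>x\<bar> / 2) n m x - gauss_abs (sqrt (state_mean d (\<lambda>m. (D m)\<^sup>2) * n)) x\<bar>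
        \<le> 2 * sqrt C + 2 * KG + 2 * KB"
      by (simp only: C_def)
  qed
qed

section \<open>The value function\<close>

lemma classic_solution_mono:
  assumes "0 \<le> C" "C \<le> C'" "t \<le> T"
  shows "classic_solution C T t \<xi> \<eta> \<le> classic_solution C' T t \<xi> \<eta>"
  unfolding classic_solution_def heat_solution_eq_gauss_abs
  using assms by (intro add_left_mono gauss_abs_mono) (simp_all add: mult_right_mono)

text \<open>
  The scaling \<open>\<xi> = \<epsilon> x\<close>, \<open>T - t = n \<epsilon>\<^sup>2\<close> turns the bounded error of the unscaled walk into
  \<open>O(\<epsilon>)\<close>.
\<close>
lemma steps_value_near_classic_solution:
  fixes d :: nat and q r :: "bool list \<Rightarrow> real"
  defines "C \<equiv> state_mean d (\<lambda>m. (q m - r m)\<^sup>2)"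
  assumes d: "d \<ge> 1"
    and q: "\<And>m. m \<in> states d \<Longrightarrow> \<bar>q m\<bar> < 1" and r: "\<And>m. m \<in> states d \<Longrightarrow> \<bar>r m\<bar> < 1"
    and C: "C > 0"
  obtains K where "K \<ge> 0" "\<And>\<epsilon> n T t m \<xi> \<eta>. \<epsilon> > 0 \<Longrightarrow> m \<in> states d \<Longrightarrow> T - t = real n * \<epsilon>\<^sup>2 \<Longrightarrow>
    \<bar>steps_value classic_data q r \<epsilon> n m \<xi> \<eta> - classic_solution C T t \<xi> \<eta>\<bar> \<le> K * \<epsilon>"
proof -
  let ?V = "walk_avg (\<lambda>m. q m - r m) (\<lambda>x. \<bar>x\<bar> / 2)"
  have D: "\<bar>q m - r m\<bar> \<le> 2" if "m \<in> states d" for m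
    using q[OF that] r[OF that] by linarith
  obtain K1 where K1: "\<And>\<epsilon> n m \<xi> \<eta>. \<epsilon> > 0 \<Longrightarrow> m \<in> states d \<Longrightarrow>
      \<bar>steps_value classic_data q r \<epsilon> n m \<xi> \<eta> - (\<epsilon> * ?V n m (\<xi> / \<epsilon>) + \<eta> / 2)\<bar> \<le> K1 * \<epsilon>"
    by (rule steps_value_near_walk_avg[OF d q r], assumption+, rule that)
  obtain K2 where K2: "\<And>n m x. m \<in> states d \<Longrightarrow> \<bar>?V n m x - gauss_abs (sqrt (C * n)) x\<bar> \<le> K2"
    by (rule walk_avg_near_heat[OF d D C[unfolded C_def]], assumption, rule that, simp only: C_def)
  show thesis
  proof (rule that[of "\<bar>K1 + K2\<bar>"])
    fix \<epsilon> T t :: real and n m \<xi> \<eta>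
    assume \<epsilon>: "\<epsilon> > 0" and m: "m \<in> states d" and t: "T - t = real n * \<epsilon>\<^sup>2"
    have "sqrt (C * (T - t)) = \<epsilon> * sqrt (C * n)"
      using \<epsilon> unfolding t by (simp add: real_sqrt_mult)
    then have "heat_solution C T t \<xi> = \<epsilon> * gauss_abs (sqrt (C * n)) (\<xi> / \<epsilon>)"
      unfolding heat_solution_eq_gauss_abs
      using gauss_abs_scale[OF \<epsilon>, of "sqrt (C * n)" "\<xi> / \<epsilon>"] \<epsilon> by simp
    then have "\<epsilon> * ?V n m (\<xi> / \<epsilon>) + \<eta> / 2 - classic_solution C T t \<xi> \<eta>
        = \<epsilon> * (?V n m (\<xi> / \<epsilon>) - gauss_abs (sqrt (C * n)) (\<xi> / \<epsilon>))"
      by (simp add: classic_solution_def right_diff_distrib)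
    also have "\<bar>\<dots>\<bar> \<le> \<epsilon> * K2"
      unfolding abs_mult using K2[OF m] \<epsilon> by (simp add: mult_left_mono)
    finally have "\<bar>\<epsilon> * ?V n m (\<xi> / \<epsilon>) + \<eta> / 2 - classic_solution C T t \<xi> \<eta>\<bar> \<le> \<epsilon> * K2" .
    with K1[OF \<epsilon> m, of n \<xi> \<eta>]
    have "\<bar>steps_value classic_data q r \<epsilon> n m \<xi> \<eta> - classic_solution C T t \<xi> \<eta>\<bar> \<le> K1 * \<epsilon> + \<epsilon> * K2"
      by linarith
    also have "\<dots> = (K1 + K2) * \<epsilon>"
      by (simp add: algebra_simps)
    also have "\<dots> \<le> \<bar>K1 + K2\<bar> * \<epsilon>"
      using \<epsilon> by (intro mult_right_mono) auto
    finally show "\<bar>steps_value classic_data q r \<epsilon> n m \<xi> \<eta> - classic_solution C T t \<xi> \<eta>\<bar>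
        \<le> \<bar>K1 + K2\<bar> * \<epsilon>" .
  qed simp
qed

theorem theorem5p8:
  fixes d :: nat and q r :: "bool list \<Rightarrow> real"
  assumes "d \<ge> 1"
    and "\<And>m. m \<in> states d \<Longrightarrow> \<bar>q m\<bar> < 1"
    and "\<And>m. m \<in> states d \<Longrightarrow> \<bar>r m\<bar> < 1"
    and "\<exists>m\<in>states d. q m \<noteq> r m"
  shows "\<exists>K \<epsilon>\<^sub>0 :: real. \<epsilon>\<^sub>0 > 0 \<and>
    (\<forall>\<epsilon> T t \<xi> \<eta> :: real. \<forall>m\<in>states d.
       0 < \<epsilon> \<longrightarrow> \<epsilon> < \<epsilon>\<^sub>0 \<longrightarrow> t < T \<longrightarrow> (T - t) / \<epsilon>\<^sup>2 \<in> \<nat> \<longrightarrow>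
         classic_solution (market_value d q r) T t \<xi> \<eta> - K * \<epsilon> * \<bar>ln \<epsilon>\<bar>
           \<le> value_function classic_data q r T \<epsilon> t m \<xi> \<eta> \<and>
         value_function classic_data q r T \<epsilon> t m \<xi> \<eta>
           \<le> classic_solution (investor_value d q r) T t \<xi> \<eta> + K * \<epsilon> * \<bar>ln \<epsilon>\<bar>)"
proof -
  define C where "C = state_mean d (\<lambda>m. (q m - r m)\<^sup>2)"
  have C: "C > 0"
  proof -
    have "(\<Sum>m\<in>states d. (q m - r m)\<^sup>2) > 0"
    proof -
      obtain m where "m \<in> states d" "q m \<noteq> r m"
        using assms(4) by blast
      then show ?thesis
        by (intro sum_pos2[OF finite_states, of m]) auto
    qed
    then show ?thesis
      using card_states_pos[of d] by (simp add: C_def state_mean_def)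
  qed
  have "(q m - r m)\<^sup>2 \<le> 4" if "m \<in> states d" for m
  proof -
    have "\<bar>q m - r m\<bar> \<le> 2"
      using assms(2,3)[OF that] by linarith
    then show ?thesis
      using abs_le_square_iff[of "q m - r m" 2] by simp
  qed
  then have investor: "C \<le> investor_value d q r"
    unfolding C_def by (rule investor_value_ge_mean[OF assms(1)])
  have market: "0 \<le> market_value d q r" "market_value d q r \<le> C"
    unfolding C_def by (rule market_value_le_mean[OF assms(1)])+
  obtain K where K: "K \<ge> 0" "\<And>\<epsilon> n T t m \<xi> \<eta>. \<epsilon> > 0 \<Longrightarrow> m \<in> states d \<Longrightarrow> T - t = real n * \<epsilon>\<^sup>2 \<Longrightarrow>
      \<bar>steps_value classic_data q r \<epsilon> n m \<xi> \<eta> - classic_solution C T t \<xi> \<eta>\<bar> \<le> K * \<epsilon>"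
    by (rule steps_value_near_classic_solution[OF assms(1-3) C[unfolded C_def]], assumption+,
        rule that, assumption, simp only: C_def)
  show ?thesis
  \<comment> \<open>Below \<open>exp (-1)\<close> the factor \<open>\<bar>ln \<epsilon>\<bar>\<close> is at least 1.\<close>
  proof (rule exI[of _ K], rule exI[of _ "exp (- 1)"], intro conjI allI ballI impI)
    fix \<epsilon> T t \<xi> \<eta> :: real and m
    assume m: "m \<in> states d" and \<epsilon>: "0 < \<epsilon>" "\<epsilon> < exp (- 1)" and t: "t < T"
      and "(T - t) / \<epsilon>\<^sup>2 \<in> \<nat>"
    then obtain n where n: "(T - t) / \<epsilon>\<^sup>2 = real n"
      by (auto elim: Nats_cases)
    then have "T - t = real n * \<epsilon>\<^sup>2"
      using \<epsilon> by (simp add: field_simps)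
    from K(2)[OF \<epsilon>(1) m this, of \<xi> \<eta>]
    have near: "\<bar>value_function classic_data q r T \<epsilon> t m \<xi> \<eta> - classic_solution C T t \<xi> \<eta>\<bar> \<le> K * \<epsilon>"
      by (simp add: value_function_def n)
    have "ln \<epsilon> < - 1"
      using \<epsilon> by (metis exp_gt_zero ln_exp ln_less_cancel_iff)
    then have log: "K * \<epsilon> \<le> K * \<epsilon> * \<bar>ln \<epsilon>\<bar>"
      using mult_left_mono[of 1 "\<bar>ln \<epsilon>\<bar>" "K * \<epsilon>"] K(1) \<epsilon>(1) by simp
    show "classic_solution (market_value d q r) T t \<xi> \<eta> - K * \<epsilon> * \<bar>ln \<epsilon>\<bar>
        \<le> value_function classic_data q r T \<epsilon> t m \<xi> \<eta>"
      using near log classic_solution_mono[OF market, of t T \<xi> \<eta>] t by linarith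
    show "value_function classic_data q r T \<epsilon> t m \<xi> \<eta>
        \<le> classic_solution (investor_value d q r) T t \<xi> \<eta> + K * \<epsilon> * \<bar>ln \<epsilon>\<bar>"
      using near log classic_solution_mono[OF less_imp_le[OF C] investor, of t T \<xi> \<eta>] t by linarith
  qed simp
qed

end
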